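(* Consider the set $\mathcal{E}$ of ellipsoids with three distinct axes in the space of quadrics $\mathcal{Q}$ of $\mathbb{R}^3$. Then the principal configurations (with respect to the Minkowski inner product on $\mathbb{R}^3$) of any two elements of $\mathcal{E}$ are principally topologically equivalent, i.e. $C^0$-principally equivalent.
   Context: The Minkowski 3-space $\mathbb{R}^{2,1}$ is $\mathbb{R}^3$ with the inner product $\langle p,q\rangle=p_1q_1+p_2q_2-p_3q_3$. The vector product is characterized by $\langle p\times q,r\rangle=\det(p,q,r)$ for all $r$; $\|p\|=\sqrt{|\langle p,p\rangle|}$. Ellipsoids in $\mathbb{R}^3$ are regarded as surfaces in $\mathbb{R}^{2,1}$. For a local parametrization $X(u,v)$ of a smooth surface $M\subset\mathbb{R}^{2,1}$, put $E=\langle X_u,X_u\rangle$, $F=\langle X_u,X_v\rangle$, $G=\langle X_v,X_v\rangle$; the tropic $LD$ is the set of points where $EG-F^2=0$. Off the tropic let $N=\pm\frac{X_u\times X_v}{\|X_u\times X_v\|}$, $e=\langle X_{uu},N\rangle$, $f=\langle X_{uv},N\rangle$, $g=\langle X_{vv},N\rangle$. The equation of principal lines is $L_1\,dv^2+M_1\,du\,dv+N_1\,du^2=0$, with $L_1=\|X_u\times X_v\|(Fg-Gf)$, $M_1=\|X_u\times X_v\|(Eg-Ge)$, $N_1=\|X_u\times X_v\|(Ef-Fe)$. It extends to the tropic since, up to a common sign, $\|X_u\times X_v\|\,e$, $\|X_u\times X_v\|\,f$, $\|X_u\times X_v\|\,g$ equal $\langle X_{uu},X_u\times X_v\rangle$,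 $\langle X_{uv},X_u\times X_v\rangle$, $\langle X_{vv},X_u\times X_v\rangle$. The umbilic set $\mathcal{U}$ is the set of points where $L_1=M_1=N_1=0$. $LPL$ is the set of points where the equation determines a unique direction, i.e. the non-umbilic points where $M_1^2-4L_1N_1=0$. Where the equation has two real directions these define two line fields $\mathcal{L}_1,\mathcal{L}_2$ (the principal directions), whose families of integral curves $\mathcal{F}_1,\mathcal{F}_2$ are the principal foliations; the integral curves are the principal lines. The principal configuration of $M$ is $\mathbb{P}_M=\{\mathcal{F}_1,\mathcal{F}_2,\mathcal{U},LD,LPL\}$. Two principal configurations $\mathbb{P}_{M_1},\mathbb{P}_{M_2}$ are $C^0$-principally equivalent if there is a homeomorphism $h:M_1\to M_2$ which sends the principal foliations, the umbilic set, $LD$ and $LPL$ of $M_1$ to the corresponding ones of $M_2$.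
   Formalization: "Three distinct axes" is taken with respect to the Minkowski inner product (any centre, Minkowski-orthonormal axes); for Euclidean axes in arbitrary position the claim fails, since a boosted ellipsoid of revolution about the time axis has three distinct Euclidean axes but only two umbilics. *)

theory Defs
  imports "HOL-Analysis.Analysis"
begin

section \<open>Minkowski 3-space\<close>

definition minner :: "real^3 \<Rightarrow> real^3 \<Rightarrow> real" where
  "minner p q = p$1 * q$1 + p$2 * q$2 - p$3 * q$3"

definition mnorm :: "real^3 \<Rightarrow> real" where
  "mnorm p = sqrt \<bar>minner p p\<bar>"

text \<open>The vector product with respect to \<^const>\<open>minner\<close>: the Euclidean one with its last
  coordinate negated. The two lemmas show that it is the vector characterized by
  \<open>\<langle>p \<times> q, r\<rangle> = det (p, q, r)\<close> for all \<open>r\<close>.\<close>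

definition mcross :: "real^3 \<Rightarrow> real^3 \<Rightarrow> real^3" where
  "mcross p q = vector [cross3 p q $ 1, cross3 p q $ 2, - (cross3 p q $ 3)]"

lemma minner_mcross: "minner (mcross p q) r = det (vector [p, q, r] :: real^3^3)"
  by (simp add: minner_def mcross_def cross3_def det_3 algebra_simps)

lemma mcross_unique:
  assumes "\<And>r. minner w r = det (vector [p, q, r] :: real^3^3)"
  shows "w = mcross p q"
proof -
  have eq: "minner w r = minner (mcross p q) r" for r
    using assms minner_mcross by simp
  show ?thesis
    using eq[of "axis 1 1"] eq[of "axis 2 1"] eq[of "axis 3 1"]
    by (simp add: minner_def vec_eq_iff forall_3 axis_def)
qed


section \<open>Local parametrizations\<close>

definition pdu :: "(real \<times> real \<Rightarrow> real^3) \<Rightarrow> real \<times> real \<Rightarrow> real^3" where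
  "pdu X q = frechet_derivative X (at q) (1, 0)"

definition pdv :: "(real \<times> real \<Rightarrow> real^3) \<Rightarrow> real \<times> real \<Rightarrow> real^3" where
  "pdv X q = frechet_derivative X (at q) (0, 1)"

text \<open>For open \<open>U\<close> this is the usual class \<open>C\<^sup>k\<close>.\<close>

primrec ck_on :: "nat \<Rightarrow> (real \<times> real) set \<Rightarrow> (real \<times> real \<Rightarrow> real^3) \<Rightarrow> bool" where
  "ck_on 0 U X \<longleftrightarrow> continuous_on U X"
| "ck_on (Suc k) U X \<longleftrightarrow> X differentiable_on U \<and> ck_on k U (pdu X) \<and> ck_on k U (pdv X)"

definition smooth_on :: "(real \<times> real) set \<Rightarrow> (real \<times> real \<Rightarrow> real^3) \<Rightarrow> bool" where
  "smooth_on U X \<longleftrightarrow> (\<forall>k. ck_on k U X)"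

definition local_param ::
    "(real^3) set \<Rightarrow> (real \<times> real) set \<Rightarrow> (real \<times> real \<Rightarrow> real^3) \<Rightarrow> bool" where
  "local_param M U X \<longleftrightarrow>
     open U \<and> smooth_on U X \<and> X ` U \<subseteq> M \<and> openin (top_of_set M) (X ` U) \<and>
     (\<exists>Y. homeomorphism U (X ` U) X Y) \<and>
     (\<forall>q\<in>U. inj (frechet_derivative X (at q)))"


section \<open>Fundamental forms and the equation of principal lines\<close>

definition Ecoef :: "(real \<times> real \<Rightarrow> real^3) \<Rightarrow> real \<times> real \<Rightarrow> real" where
  "Ecoef X q = minner (pdu X q) (pdu X q)"

definition Fcoef :: "(real \<times> real \<Rightarrow> real^3) \<Rightarrow> real \<times> real \<Rightarrow> real" where
  "Fcoef X q = minner (pdu X q) (pdv X q)"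

definition Gcoef :: "(real \<times> real \<Rightarrow> real^3) \<Rightarrow> real \<times> real \<Rightarrow> real" where
  "Gcoef X q = minner (pdv X q) (pdv X q)"

definition unit_normal :: "(real \<times> real \<Rightarrow> real^3) \<Rightarrow> real \<times> real \<Rightarrow> real^3" where
  "unit_normal X q = mcross (pdu X q) (pdv X q) /\<^sub>R mnorm (mcross (pdu X q) (pdv X q))"

text \<open>The products \<open>\<parallel>X\<^sub>u \<times> X\<^sub>v\<parallel> e\<close>, \<open>\<parallel>X\<^sub>u \<times> X\<^sub>v\<parallel> f\<close>, \<open>\<parallel>X\<^sub>u \<times> X\<^sub>v\<parallel> g\<close> in the form that makes
  sense on the tropic too. The other choice of sign for the unit normal changes the sign of all
  three, hence of all coefficients of the equation of principal lines.\<close>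

definition ebar :: "(real \<times> real \<Rightarrow> real^3) \<Rightarrow> real \<times> real \<Rightarrow> real" where
  "ebar X q = minner (pdu (pdu X) q) (mcross (pdu X q) (pdv X q))"

definition fbar :: "(real \<times> real \<Rightarrow> real^3) \<Rightarrow> real \<times> real \<Rightarrow> real" where
  "fbar X q = minner (pdv (pdu X) q) (mcross (pdu X q) (pdv X q))"

definition gbar :: "(real \<times> real \<Rightarrow> real^3) \<Rightarrow> real \<times> real \<Rightarrow> real" where
  "gbar X q = minner (pdv (pdv X) q) (mcross (pdu X q) (pdv X q))"

definition L1 :: "(real \<times> real \<Rightarrow> real^3) \<Rightarrow> real \<times> real \<Rightarrow> real" where
  "L1 X q = Fcoef X q * gbar X q - Gcoef X q * fbar X q"

definition M1 :: "(real \<times> real \<Rightarrow> real^3) \<Rightarrow> real \<times> real \<Rightarrow> real" where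
  "M1 X q = Ecoef X q * gbar X q - Gcoef X q * ebar X q"

definition N1 :: "(real \<times> real \<Rightarrow> real^3) \<Rightarrow> real \<times> real \<Rightarrow> real" where
  "N1 X q = Ecoef X q * fbar X q - Fcoef X q * ebar X q"

lemma minner_mcross_self:
  "minner (mcross p q) (mcross p q) = - (minner p p * minner q q - (minner p q)\<^sup>2)"
  by (simp add: minner_def mcross_def cross3_def power2_eq_square algebra_simps)

lemma bar_coefs_off_tropic:
  assumes "Ecoef X q * Gcoef X q - (Fcoef X q)\<^sup>2 \<noteq> 0"
  defines "n \<equiv> mnorm (mcross (pdu X q) (pdv X q))"
  shows "ebar X q = n * minner (pdu (pdu X) q) (unit_normal X q)"
    and "fbar X q = n * minner (pdv (pdu X) q) (unit_normal X q)"
    and "gbar X q = n * minner (pdv (pdv X) q) (unit_normal X q)"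
proof -
  have "n \<noteq> 0"
    using assms by (simp add: n_def mnorm_def minner_mcross_self Ecoef_def Fcoef_def Gcoef_def)
  then have "minner w (mcross (pdu X q) (pdv X q)) = n * minner w (unit_normal X q)" for w
    by (simp add: minner_def unit_normal_def flip: n_def) (simp add: field_simps)
  then show "ebar X q = n * minner (pdu (pdu X) q) (unit_normal X q)"
    and "fbar X q = n * minner (pdv (pdu X) q) (unit_normal X q)"
    and "gbar X q = n * minner (pdv (pdv X) q) (unit_normal X q)"
    by (simp_all add: ebar_def fbar_def gbar_def)
qed


section \<open>The principal configuration\<close>

text \<open>The conditions below do not depend on the local parametrization around the point.\<close>

definition tropic :: "(real^3) set \<Rightarrow> (real^3) set" where
  "tropic M = {X q | U X q. local_param M U X \<and> q \<in> U \<and>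
     Ecoef X q * Gcoef X q - (Fcoef X q)\<^sup>2 = 0}"

definition umbilics :: "(real^3) set \<Rightarrow> (real^3) set" where
  "umbilics M = {X q | U X q. local_param M U X \<and> q \<in> U \<and>
     L1 X q = 0 \<and> M1 X q = 0 \<and> N1 X q = 0}"

definition LPL :: "(real^3) set \<Rightarrow> (real^3) set" where
  "LPL M = {X q | U X q. local_param M U X \<and> q \<in> U \<and>
     \<not> (L1 X q = 0 \<and> M1 X q = 0 \<and> N1 X q = 0) \<and> (M1 X q)\<^sup>2 - 4 * L1 X q * N1 X q = 0}"

definition two_direction_region :: "(real^3) set \<Rightarrow> (real^3) set" where
  "two_direction_region M = {X q | U X q. local_param M U X \<and> q \<in> U \<and>
     (M1 X q)\<^sup>2 - 4 * L1 X q * N1 X q > 0}"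

text \<open>The principal directions at \<open>p\<close>, as lines through the origin.\<close>

definition principal_directions :: "(real^3) set \<Rightarrow> real^3 \<Rightarrow> (real^3) set set" where
  "principal_directions M p =
     {span {du *\<^sub>R pdu X q + dv *\<^sub>R pdv X q} | U X q du dv.
        local_param M U X \<and> q \<in> U \<and> X q = p \<and> (du, dv) \<noteq> (0, 0) \<and>
        L1 X q * dv\<^sup>2 + M1 X q * du * dv + N1 X q * du\<^sup>2 = 0}"

definition continuous_line_field :: "(real^3) set \<Rightarrow> (real^3 \<Rightarrow> (real^3) set) \<Rightarrow> bool" where
  "continuous_line_field R D \<longleftrightarrow>
     (\<forall>p\<in>R. \<exists>W V. openin (top_of_set R) W \<and> p \<in> W \<and> continuous_on W V \<and>
        (\<forall>q\<in>W. V q \<noteq> (0 :: real^3) \<and> D q = span {V q}))"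

text \<open>The principal directions do not come with a numbering; a pair of principal line fields is a
  continuous choice of one.\<close>

definition principal_line_fields ::
    "(real^3) set \<Rightarrow> (real^3 \<Rightarrow> (real^3) set) \<Rightarrow> (real^3 \<Rightarrow> (real^3) set) \<Rightarrow> bool" where
  "principal_line_fields M D1 D2 \<longleftrightarrow>
     continuous_line_field (two_direction_region M) D1 \<and>
     continuous_line_field (two_direction_region M) D2 \<and>
     (\<forall>p\<in>two_direction_region M. D1 p \<noteq> D2 p \<and> principal_directions M p = {D1 p, D2 p})"

definition integral_curve ::
    "(real^3) set \<Rightarrow> (real^3 \<Rightarrow> (real^3) set) \<Rightarrow> real set \<Rightarrow> (real \<Rightarrow> real^3) \<Rightarrow> bool" where
  "integral_curve R D I \<gamma> \<longleftrightarrow>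
     I \<noteq> {} \<and> open I \<and> is_interval I \<and> \<gamma> ` I \<subseteq> R \<and>
     (\<exists>\<gamma>'. continuous_on I \<gamma>' \<and>
        (\<forall>t\<in>I. (\<gamma> has_vector_derivative \<gamma>' t) (at t) \<and> \<gamma>' t \<noteq> 0 \<and> \<gamma>' t \<in> D (\<gamma> t)))"

definition integral_traces ::
    "(real^3) set \<Rightarrow> (real^3 \<Rightarrow> (real^3) set) \<Rightarrow> (real^3) set set" where
  "integral_traces R D = {\<gamma> ` I | I \<gamma>. integral_curve R D I \<gamma>}"

text \<open>A foliation is given by its leaves, the traces of the maximal integral curves.\<close>

definition foliation ::
    "(real^3) set \<Rightarrow> (real^3 \<Rightarrow> (real^3) set) \<Rightarrow> (real^3) set set" where
  "foliation R D = {C \<in> integral_traces R D. \<forall>C'\<in>integral_traces R D. C \<subseteq> C' \<longrightarrow> C' = C}"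

type_synonym configuration =
  "(real^3) set set \<times> (real^3) set set \<times> (real^3) set \<times> (real^3) set \<times> (real^3) set"

text \<open>The principal configurations \<open>(\<F>\<^sub>1, \<F>\<^sub>2, \<U>, LD, LPL)\<close> of \<open>M\<close>, one for each numbering of the
  principal line fields.\<close>

definition principal_configurations :: "(real^3) set \<Rightarrow> configuration set" where
  "principal_configurations M =
     {(foliation (two_direction_region M) D1, foliation (two_direction_region M) D2,
       umbilics M, tropic M, LPL M) | D1 D2. principal_line_fields M D1 D2}"

fun map_configuration :: "(real^3 \<Rightarrow> real^3) \<Rightarrow> configuration \<Rightarrow> configuration" where
  "map_configuration h (F1, F2, Um, LD, P) =
     ((\<lambda>C. h ` C) ` F1, (\<lambda>C. h ` C) ` F2, h ` Um, h ` LD, h ` P)"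

definition C0_principally_equivalent :: "(real^3) set \<Rightarrow> (real^3) set \<Rightarrow> bool" where
  "C0_principally_equivalent M M' \<longleftrightarrow>
     (\<exists>h k. homeomorphism M M' h k \<and>
        (\<exists>P\<in>principal_configurations M. \<exists>P'\<in>principal_configurations M'.
           map_configuration h P = P'))"


section \<open>Ellipsoids\<close>

definition minkowski_frame :: "real^3 \<Rightarrow> real^3 \<Rightarrow> real^3 \<Rightarrow> bool" where
  "minkowski_frame e1 e2 e3 \<longleftrightarrow>
     minner e1 e1 = 1 \<and> minner e2 e2 = 1 \<and> minner e3 e3 = - 1 \<and>
     minner e1 e2 = 0 \<and> minner e1 e3 = 0 \<and> minner e2 e3 = 0"

text \<open>Axes are understood with respect to the Minkowski inner product: every ellipsoid has
  the equation below for some centre \<open>o'\<close>, orthonormal frame and semi-axes, since a positive definite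
  form and \<^const>\<open>minner\<close> are simultaneously diagonalizable. Distinct Euclidean axes would not do:
  a Lorentz boost turns an ellipsoid of revolution about the time axis, which has two umbilics,
  into an ellipsoid with three distinct Euclidean axes.\<close>

definition ellipsoids_distinct_axes :: "(real^3) set set" where
  "ellipsoids_distinct_axes =
     {{p. (minner (p - o') e1 / a)\<^sup>2 + (minner (p - o') e2 / b)\<^sup>2 + (minner (p - o') e3 / c)\<^sup>2 = 1}
      | o' e1 e2 e3 a b c.
        minkowski_frame e1 e2 e3 \<and> 0 < a \<and> 0 < b \<and> 0 < c \<and> a \<noteq> b \<and> b \<noteq> c \<and> a \<noteq> c}"

lemma standard_ellipsoid_distinct_axes:
  assumes "0 < a" "0 < b" "0 < c" "a \<noteq> b" "b \<noteq> c" "a \<noteq> c"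
  shows "{p :: real^3. (p$1)\<^sup>2 / a\<^sup>2 + (p$2)\<^sup>2 / b\<^sup>2 + (p$3)\<^sup>2 / c\<^sup>2 = 1} \<in> ellipsoids_distinct_axes"
proof -
  have "minkowski_frame (axis 1 1) (axis 2 1) (axis 3 1)"
    by (simp add: minkowski_frame_def minner_def axis_def)
  moreover have "{p :: real^3. (p$1)\<^sup>2 / a\<^sup>2 + (p$2)\<^sup>2 / b\<^sup>2 + (p$3)\<^sup>2 / c\<^sup>2 = 1} =
      {p. (minner (p - 0) (axis 1 1) / a)\<^sup>2 + (minner (p - 0) (axis 2 1) / b)\<^sup>2 +
          (minner (p - 0) (axis 3 1) / c)\<^sup>2 = 1}"
    by (simp add: minner_def axis_def power_divide)
  ultimately show ?thesis
    unfolding ellipsoids_distinct_axes_def using assms by blast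
qed

end

theory Submission
  imports Defs
begin

text \<open>An affine map carries the unit sphere onto the ellipsoid so that the pulled back Minkowski form is
  diagonal, \<open>A x\<^sub>1 y\<^sub>1 + B x\<^sub>2 y\<^sub>2 - C x\<^sub>3 y\<^sub>3\<close> with \<open>A > B > 0\<close> and \<open>C > 0\<close>; the order of \<open>A\<close> and \<open>B\<close> is a
  matter of naming the spacelike axes. The second fundamental form of a quadric becomes, up to a
  nowhere vanishing factor, the Euclidean inner product on the tangent planes of the sphere
  (\<open>local_param_frame\<close>): this holds because \<open>\<langle>X\<^sub>u\<^sub>u, X\<^sub>u \<times> X\<^sub>v\<rangle>\<close> and its companions are
  determinants, hence affine notions. So the principal directions at \<open>x\<close> are the eigenlines of the
  diagonal form restricted to the plane orthogonal to \<open>x\<close>. Since the Euclidean product is definite,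
  these are two distinct real lines unless the two eigenvalues coincide; in that case \<open>x\<close> is umbilic.
  In particular \<open>LPL\<close> is empty, and the foliations live on the complement of the umbilic set.

  Subtracting a multiple of the Euclidean product and rescaling turns the form into
  \<open>p x\<^sub>1 y\<^sub>1 - (1 - p) x\<^sub>3 y\<^sub>3\<close> with \<open>0 < p < 1\<close>, and this does not change the eigenlines. Its eigenvalues on the
  tangent plane are \<open>p u\<close> and \<open>- (1 - p) v\<close> with \<open>u, v\<close> in the unit interval, and \<open>(u, v)\<close> are the
  sphero-conical coordinates: together with the signs of the coordinates they determine \<open>x\<close>, because
  \<open>x\<^sub>1\<^sup>2 = (1 - u) (p + (1 - p) v)\<close>, \<open>x\<^sub>2\<^sup>2 = u v\<close> and \<open>x\<^sub>3\<^sup>2 = (1 - v) (1 - p + p u)\<close>. Everything in the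
  configuration can be read off in these coordinates. The umbilics are given by \<open>u = v = 0\<close>, the tropic by
  \<open>v = B / (B + C)\<close>. Along an eigenline of \<open>p u\<close> the function \<open>v\<close> is constant, so the leaves of
  one foliation are the fibres of \<open>(v, sgn x\<^sub>3)\<close>, each of which is traced by an explicit curve
  (\<open>leaf_label_constant_along_first_line\<close>, \<open>leaf_curve\<close>). The symmetry exchanging the first and the third
  axis gives the leaves of the other foliation as the fibres of \<open>(u, sgn x\<^sub>1)\<close>.

  Hence a homeomorphism between two ellipsoids is obtained by keeping \<open>u\<close> and the signs of the
  coordinates and by reparametrizing \<open>v\<close> with an increasing homeomorphism of the unit interval that
  carries \<open>B / (B + C)\<close> to \<open>B' / (B' + C')\<close>; it respects fibres, umbilics and tropic
  (\<open>lorentz_ellipsoids_equivalent\<close>).\<close>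

section \<open>Sphero-conical coordinates\<close>

text \<open>On the plane orthogonal to a unit vector \<open>x\<close> the quadratic form \<open>p y\<^sub>1\<^sup>2 - (1 - p) y\<^sub>3\<^sup>2\<close> has trace
  \<open>eigenvalue_sum p x\<close> and determinant \<open>- p (1 - p) x\<^sub>2\<^sup>2\<close>; the gap is the square root of the discriminant of
  its characteristic polynomial. The eigenvalues are \<open>p u \<ge> 0 \<ge> - (1 - p) v\<close>, where \<open>u\<close> and \<open>v\<close> are normalized so as to
  range over the unit interval on the sphere.\<close>
definition eigenvalue_sum :: "real \<Rightarrow> real^3 \<Rightarrow> real" where
  "eigenvalue_sum p x = p * (1 - (x$1)\<^sup>2) - (1 - p) * (1 - (x$3)\<^sup>2)"

definition eigenvalue_gap :: "real \<Rightarrow> real^3 \<Rightarrow> real" where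
  "eigenvalue_gap p x = sqrt ((eigenvalue_sum p x)\<^sup>2 + 4 * p * (1 - p) * (x$2)\<^sup>2)"

definition conic_u :: "real \<Rightarrow> real^3 \<Rightarrow> real" where
  "conic_u p x = (eigenvalue_gap p x + eigenvalue_sum p x) / (2 * p)"

definition conic_v :: "real \<Rightarrow> real^3 \<Rightarrow> real" where
  "conic_v p x = (eigenvalue_gap p x - eigenvalue_sum p x) / (2 * (1 - p))"

lemma in_sphere_iff: "(x :: real^3) \<in> sphere 0 1 \<longleftrightarrow> (x$1)\<^sup>2 + (x$2)\<^sup>2 + (x$3)\<^sup>2 = 1"
proof -
  have "x \<in> sphere 0 1 \<longleftrightarrow> x \<bullet> x = 1"
    by (simp add: norm_eq_1)
  then show ?thesis
    by (simp add: inner_vec_def sum_3 power2_eq_square)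
qed

lemma eigenvalue_gap_square:
  assumes "0 < p" "p < 1"
  shows "(eigenvalue_gap p x)\<^sup>2 = (eigenvalue_sum p x)\<^sup>2 + 4 * p * (1 - p) * (x$2)\<^sup>2"
  using assms by (simp add: eigenvalue_gap_def)

lemma abs_eigenvalue_sum_le_gap:
  assumes "0 < p" "p < 1"
  shows "\<bar>eigenvalue_sum p x\<bar> \<le> eigenvalue_gap p x"
  unfolding eigenvalue_gap_def using assms by (intro real_le_rsqrt) simp

lemma conic_eqs:
  assumes "0 < p" "p < 1"
  shows "eigenvalue_sum p x = p * conic_u p x - (1 - p) * conic_v p x"
    and "eigenvalue_gap p x = p * conic_u p x + (1 - p) * conic_v p x"
proof -
  have "2 * p * conic_u p x = eigenvalue_gap p x + eigenvalue_sum p x" "2 * (1 - p) * conic_v p x = eigenvalue_gap p x - eigenvalue_sum p x"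
    using assms by (simp_all add: conic_u_def conic_v_def)
  then show "eigenvalue_sum p x = p * conic_u p x - (1 - p) * conic_v p x"
    and "eigenvalue_gap p x = p * conic_u p x + (1 - p) * conic_v p x"
    by linarith+
qed

lemma conic_nonneg:
  assumes "0 < p" "p < 1"
  shows "0 \<le> conic_u p x" "0 \<le> conic_v p x"
  using abs_eigenvalue_sum_le_gap[OF assms, of x] assms by (simp_all add: conic_u_def conic_v_def)

lemma sq2_conic:
  assumes p: "0 < p" "p < 1"
  shows "(x$2)\<^sup>2 = conic_u p x * conic_v p x"
proof -
  have "4 * p * (1 - p) * (x$2)\<^sup>2 = (eigenvalue_gap p x)\<^sup>2 - (eigenvalue_sum p x)\<^sup>2"
    using eigenvalue_gap_square[OF p] by simp
  also have "\<dots> = 4 * p * (1 - p) * (conic_u p x * conic_v p x)"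
    unfolding conic_eqs[OF p] by algebra
  finally show ?thesis
    using p by simp
qed

lemma sq13_conic:
  assumes p: "0 < p" "p < 1" and x: "x \<in> sphere 0 1"
  shows "(x$1)\<^sup>2 = (1 - conic_u p x) * (p + (1 - p) * conic_v p x)"
    and "(x$3)\<^sup>2 = (1 - conic_v p x) * (1 - p + p * conic_u p x)"
proof -
  have *: "(x$1)\<^sup>2 + conic_u p x * conic_v p x + (x$3)\<^sup>2 = 1"
    using x[unfolded in_sphere_iff] sq2_conic[OF p, of x] by simp
  have **: "p * (1 - (x$1)\<^sup>2) - (1 - p) * (1 - (x$3)\<^sup>2)
      = p * conic_u p x - (1 - p) * conic_v p x"
    using conic_eqs(1)[OF p, of x] by (simp add: eigenvalue_sum_def)
  show "(x$1)\<^sup>2 = (1 - conic_u p x) * (p + (1 - p) * conic_v p x)"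
    using * ** by algebra
  show "(x$3)\<^sup>2 = (1 - conic_v p x) * (1 - p + p * conic_u p x)"
    using * ** by algebra
qed

text \<open>The upper bounds follow from the formulas for \<open>x\<^sub>1\<^sup>2\<close> and \<open>x\<^sub>3\<^sup>2\<close>: these products are nonnegative and their
  second factors are positive.\<close>
lemma conic_le_1:
  assumes p: "0 < p" "p < 1" and x: "x \<in> sphere 0 1"
  shows "conic_u p x \<le> 1" "conic_v p x \<le> 1"
proof -
  have "0 < p + (1 - p) * conic_v p x" "0 < 1 - p + p * conic_u p x"
    using conic_nonneg[OF p, of x] p by (simp_all add: add_pos_nonneg)
  moreover have "0 \<le> (1 - conic_u p x) * (p + (1 - p) * conic_v p x)"
      "0 \<le> (1 - conic_v p x) * (1 - p + p * conic_u p x)"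
    using sq13_conic[OF p x] by (metis zero_le_power2)+
  ultimately show "conic_u p x \<le> 1" "conic_v p x \<le> 1"
    by (simp_all add: zero_le_mult_iff)
qed

text \<open>The converse of the three formulas: it identifies the coordinates of points that are given by
  explicit expressions.\<close>
lemma conic_unique:
  assumes p: "0 < p" "p < 1" and uv: "0 \<le> u" "0 \<le> v"
    and x: "(x$1)\<^sup>2 = (1 - u) * (p + (1 - p) * v)" "(x$2)\<^sup>2 = u * v"
      "(x$3)\<^sup>2 = (1 - v) * (1 - p + p * u)"
  shows "x \<in> sphere 0 1" "conic_u p x = u" "conic_v p x = v"
proof -
  show "x \<in> sphere 0 1"
    unfolding in_sphere_iff x by algebra
  have t: "eigenvalue_sum p x = p * u - (1 - p) * v"
    unfolding eigenvalue_sum_def x by algebra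
  have "(eigenvalue_sum p x)\<^sup>2 + 4 * p * (1 - p) * (x$2)\<^sup>2 = (p * u + (1 - p) * v)\<^sup>2"
    unfolding t x by algebra
  then have g: "eigenvalue_gap p x = p * u + (1 - p) * v"
    using p uv by (simp add: eigenvalue_gap_def)
  show "conic_u p x = u" "conic_v p x = v"
    using p by (simp_all add: conic_u_def conic_v_def t g divide_simps)
qed

lemma continuous_on_conic [continuous_intros]:
  assumes "continuous_on S f"
  shows "continuous_on S (\<lambda>y. conic_u p (f y))" "continuous_on S (\<lambda>y. conic_v p (f y))"
proof -
  have "continuous_on S (\<lambda>y. eigenvalue_sum p (f y))" "continuous_on S (\<lambda>y. eigenvalue_gap p (f y))"
    unfolding eigenvalue_gap_def eigenvalue_sum_def using assms by (intro continuous_intros; simp)+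
  then show "continuous_on S (\<lambda>y. conic_u p (f y))" "continuous_on S (\<lambda>y. conic_v p (f y))"
    unfolding conic_u_def conic_v_def divide_inverse by (intro continuous_intros; simp)+
qed

text \<open>Exchanging the extreme axes replaces the form by the negative of the one with parameter \<open>1 - p\<close>.
  It interchanges the two eigenvalues, hence \<open>u\<close> with \<open>v\<close> and the two foliations, so that only one of them has
  to be studied.\<close>
definition flip :: "real^3 \<Rightarrow> real^3" where
  "flip x = vector [x$3, x$2, x$1]"

lemma flip_nth [simp]: "flip x $ 1 = x$3" "flip x $ 2 = x$2" "flip x $ 3 = x$1"
  by (simp_all add: flip_def)

lemma flip_flip [simp]: "flip (flip x) = x"
  by (simp add: vec_eq_iff forall_3)

lemma linear_flip: "linear flip"
  by (intro linearI) (simp_all add: vec_eq_iff forall_3)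

lemma flip_in_sphere [simp]: "flip x \<in> sphere 0 1 \<longleftrightarrow> x \<in> sphere 0 1"
  unfolding in_sphere_iff by (simp add: add_ac)

lemma eigenvalue_sum_flip [simp]: "eigenvalue_sum (1 - p) (flip x) = - eigenvalue_sum p x"
  by (simp add: eigenvalue_sum_def)

lemma eigenvalue_gap_flip [simp]: "eigenvalue_gap (1 - p) (flip x) = eigenvalue_gap p x"
  by (simp add: eigenvalue_gap_def)

lemma conic_u_flip [simp]: "conic_u (1 - p) (flip x) = conic_v p x"
  by (simp add: conic_u_def conic_v_def)

section \<open>Eigenlines on the tangent planes of the sphere\<close>

text \<open>The self-adjoint operator of the normalized form. An eigenvector of the restricted form is a tangent
  vector whose image under this operator differs from a multiple of it by a normal vector.\<close>
definition form_op :: "real \<Rightarrow> real^3 \<Rightarrow> real^3" where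
  "form_op p w = vector [p * w$1, 0, - ((1 - p) * w$3)]"

lemma form_op_nth [simp]:
  "form_op p w $ 1 = p * w$1" "form_op p w $ 2 = 0" "form_op p w $ 3 = - ((1 - p) * w$3)"
  by (simp_all add: form_op_def)

lemma inner_real3: "(x :: real^3) \<bullet> y = x$1 * y$1 + x$2 * y$2 + x$3 * y$3"
  by (simp add: inner_vec_def sum_3)

lemma linear_form_op: "linear (form_op p)"
  by (intro linearI) (simp_all add: vec_eq_iff forall_3 algebra_simps)

lemma form_op_selfadjoint: "form_op p x \<bullet> y = x \<bullet> form_op p y"
  by (simp add: inner_real3)

definition eigenspace :: "real \<Rightarrow> real^3 \<Rightarrow> real \<Rightarrow> (real^3) set" where
  "eigenspace p x \<nu> = {w. w \<bullet> x = 0 \<and> (\<exists>t. form_op p w = \<nu> *\<^sub>R w + t *\<^sub>R x)}"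

lemma subspace_eigenspace: "subspace (eigenspace p x \<nu>)"
proof (rule subspaceI)
  show "0 \<in> eigenspace p x \<nu>"
    by (simp add: eigenspace_def linear_0[OF linear_form_op] exI[of _ 0])
next
  fix w z assume "w \<in> eigenspace p x \<nu>" "z \<in> eigenspace p x \<nu>"
  then obtain t t' where "w \<bullet> x = 0" "form_op p w = \<nu> *\<^sub>R w + t *\<^sub>R x"
      "z \<bullet> x = 0" "form_op p z = \<nu> *\<^sub>R z + t' *\<^sub>R x"
    by (auto simp: eigenspace_def)
  then have "(w + z) \<bullet> x = 0" "form_op p (w + z) = \<nu> *\<^sub>R (w + z) + (t + t') *\<^sub>R x"
    by (simp_all add: inner_simps linear_add[OF linear_form_op] algebra_simps)
  then show "w + z \<in> eigenspace p x \<nu>"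
    unfolding eigenspace_def by blast
next
  fix c w assume "w \<in> eigenspace p x \<nu>"
  then obtain t where "w \<bullet> x = 0" "form_op p w = \<nu> *\<^sub>R w + t *\<^sub>R x"
    by (auto simp: eigenspace_def)
  then have "(c *\<^sub>R w) \<bullet> x = 0" "form_op p (c *\<^sub>R w) = \<nu> *\<^sub>R (c *\<^sub>R w) + (c * t) *\<^sub>R x"
    by (simp_all add: linear_cmul[OF linear_form_op] algebra_simps)
  then show "c *\<^sub>R w \<in> eigenspace p x \<nu>"
    unfolding eigenspace_def by blast
qed

text \<open>With \<open>\<alpha> = (p, 0, - (1 - p))\<close> the equation for an eigenvector is \<open>(\<alpha>\<^sub>i - \<nu>) w\<^sub>i = t x\<^sub>i\<close>. The
  characteristic polynomial is \<open>ch = \<Sum>\<^sub>i x\<^sub>i\<^sup>2 \<Prod>\<^sub>j\<^sub>\<noteq>\<^sub>i (\<alpha>\<^sub>j - \<nu>)\<close>, and orthogonality of \<open>w\<close> and \<open>x\<close> forces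
  \<open>t ch = 0\<close>; if \<open>t = 0\<close>, then \<open>w\<close> lies on a coordinate axis and \<open>ch = 0\<close> as well. Conversely, if
  \<open>ch = 0\<close>, multiplying \<open>x\<close> with the adjugate of \<open>diag (\<alpha> - \<nu>)\<close> gives an eigenvector; where this product
  vanishes, \<open>\<nu>\<close> is one of the \<open>\<alpha>\<^sub>i\<close> and the corresponding coordinate axis is an eigenvector.\<close>
lemma eigenvalue_iff:
  assumes p: "0 < p" "p < 1" and x: "x \<in> sphere 0 1"
  shows "(\<exists>w. w \<noteq> 0 \<and> w \<in> eigenspace p x \<nu>) \<longleftrightarrow>
     \<nu> = p * conic_u p x \<or> \<nu> = - (1 - p) * conic_v p x"
proof -
  define ch where "ch = (- \<nu>) * (-(1-p) - \<nu>) * (x$1)\<^sup>2 + (p - \<nu>) * (-(1-p) - \<nu>) * (x$2)\<^sup>2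
      + (p - \<nu>) * (- \<nu>) * (x$3)\<^sup>2"
  have fac: "ch = (\<nu> - p * conic_u p x) * (\<nu> - (- (1 - p) * conic_v p x))"
    unfolding ch_def sq13_conic[OF p x] sq2_conic[OF p] by algebra
  have eq: "form_op p w = \<nu> *\<^sub>R w + t *\<^sub>R x \<longleftrightarrow>
     (p - \<nu>) * w$1 = t * x$1 \<and> (- \<nu>) * w$2 = t * x$2 \<and> (-(1-p) - \<nu>) * w$3 = t * x$3" for w t
    by (auto simp: vec_eq_iff forall_3 algebra_simps)
  have "(\<exists>w. w \<noteq> 0 \<and> w \<in> eigenspace p x \<nu>) \<longleftrightarrow> ch = 0"
  proof
    assume "\<exists>w. w \<noteq> 0 \<and> w \<in> eigenspace p x \<nu>"
    then obtain w t where w: "w \<noteq> 0" "w \<bullet> x = 0" and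
      t: "(p - \<nu>) * w$1 = t * x$1" "(- \<nu>) * w$2 = t * x$2" "(-(1-p) - \<nu>) * w$3 = t * x$3"
      unfolding eigenspace_def using eq by auto
    have "t * ch = (p - \<nu>) * (- \<nu>) * (-(1-p) - \<nu>) * (w \<bullet> x)"
    proof -
      have "t * ch = (- \<nu>) * (-(1-p) - \<nu>) * (t * x$1) * x$1 + (p - \<nu>) * (-(1-p) - \<nu>) * (t * x$2) * x$2
      + (p - \<nu>) * (- \<nu>) * (t * x$3) * x$3"
        unfolding ch_def by algebra
      then show ?thesis unfolding t[symmetric] inner_real3 by algebra
    qed
    then have *: "t * ch = 0" using w by simp
    show "ch = 0"
    proof (cases "t = 0")
      case True
      have "w$1 \<noteq> 0 \<or> w$2 \<noteq> 0 \<or> w$3 \<noteq> 0"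
        using w by (simp add: vec_eq_iff forall_3)
      then consider "w$1 \<noteq> 0" "\<nu> = p" | "w$2 \<noteq> 0" "\<nu> = 0" | "w$3 \<noteq> 0" "\<nu> = -(1-p)"
        using t True by force
      then show ?thesis
      proof cases
        case 1
        then have "w$2 = 0" "w$3 = 0" using t True p by auto
        then show ?thesis using w 1 by (simp add: ch_def inner_real3)
      next
        case 2
        then have "w$1 = 0" "w$3 = 0" using t True p by auto
        then show ?thesis using w 2 by (simp add: ch_def inner_real3)
      next
        case 3
        then have "w$1 = 0" "w$2 = 0" using t True p by auto
        then show ?thesis using w 3 by (simp add: ch_def inner_real3)
      qed
    qed (use * in simp)
  next
    assume 0: "ch = 0"
    define n :: "real^3" where "n = vector [(- \<nu>) * (-(1-p) - \<nu>) * x$1,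
      (p - \<nu>) * (-(1-p) - \<nu>) * x$2, (p - \<nu>) * (- \<nu>) * x$3]"
    have n: "n \<in> eigenspace p x \<nu>"
      unfolding eigenspace_def mem_Collect_eq eq
    proof
      show "n \<bullet> x = 0"
        using 0 by (simp add: n_def inner_real3 ch_def power2_eq_square mult.assoc)
      show "\<exists>t. (p - \<nu>) * n$1 = t * x$1 \<and> (- \<nu>) * n$2 = t * x$2 \<and> (-(1-p) - \<nu>) * n$3 = t * x$3"
        by (rule exI[of _ "(p - \<nu>) * (- \<nu>) * (-(1-p) - \<nu>)"]) (simp add: n_def)
    qed
    show "\<exists>w. w \<noteq> 0 \<and> w \<in> eigenspace p x \<nu>"
    proof (cases "n = 0")
      case True
      then have n0: "(- \<nu>) * (-(1-p) - \<nu>) * x$1 = 0" "(p - \<nu>) * (-(1-p) - \<nu>) * x$2 = 0"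
        "(p - \<nu>) * (- \<nu>) * x$3 = 0"
        by (simp_all add: n_def vec_eq_iff forall_3)
      have "x \<noteq> 0" using x by auto
      then have "x$1 \<noteq> 0 \<or> x$2 \<noteq> 0 \<or> x$3 \<noteq> 0" by (simp add: vec_eq_iff forall_3)
      then have "\<nu> = p \<or> \<nu> = 0 \<or> \<nu> = -(1-p)" using n0 by force
      then obtain i where i: "x$i = 0" "form_op p (axis i 1) = \<nu> *\<^sub>R axis i 1"
      proof (elim disjE)
        assume "\<nu> = p" then show ?thesis using n0 p that[of 1]
          by (force simp: vec_eq_iff forall_3 axis_def)
      next
        assume "\<nu> = 0" then show ?thesis using n0 p that[of 2]
          by (force simp: vec_eq_iff forall_3 axis_def)
      next
        assume "\<nu> = -(1-p)" then show ?thesis using n0 p that[of 3]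
          by (force simp: vec_eq_iff forall_3 axis_def)
      qed
      then have "axis i 1 \<in> eigenspace p x \<nu>"
        unfolding eigenspace_def by (simp add: inner_axis' exI[of _ 0])
      then show ?thesis by (metis axis_eq_0_iff zero_neq_one)
    qed (use n in blast)
  qed
  then show ?thesis
    unfolding fac mult_eq_0_iff right_minus_eq .
qed

lemma eigenspaces_orthogonal:
  assumes "w \<in> eigenspace p x \<nu>" "z \<in> eigenspace p x \<nu>'" "\<nu> \<noteq> \<nu>'"
  shows "w \<bullet> z = 0"
proof -
  obtain t t' where "form_op p w = \<nu> *\<^sub>R w + t *\<^sub>R x" "form_op p z = \<nu>' *\<^sub>R z + t' *\<^sub>R x"
      "w \<bullet> x = 0" "z \<bullet> x = 0"
    using assms unfolding eigenspace_def by auto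
  then have "\<nu> * (w \<bullet> z) = \<nu>' * (w \<bullet> z)"
    using form_op_selfadjoint[of p w z] by (simp add: inner_simps inner_commute)
  then show ?thesis using assms(3) by simp
qed

lemma orthogonal_triple_expand:
  fixes x w z v :: "real^3"
  assumes "x \<noteq> 0" "w \<noteq> 0" "z \<noteq> 0" "w \<bullet> x = 0" "z \<bullet> x = 0" "w \<bullet> z = 0"
  obtains a b c where "v = a *\<^sub>R w + b *\<^sub>R z + c *\<^sub>R x"
proof -
  have d: "x \<noteq> w" "x \<noteq> z" "w \<noteq> z" using assms by auto
  have "independent {w, z, x}"
    by (rule pairwise_orthogonal_independent)
      (use assms in \<open>auto simp: pairwise_def orthogonal_def inner_commute\<close>)
  moreover have "card {w, z, x} = DIM(real^3)" using d by auto
  ultimately have "v \<in> span {w, z, x}"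
    using card_ge_dim_independent[of "{w,z,x}" UNIV] by (simp add: dim_UNIV) blast
  then obtain a b c where "v - a *\<^sub>R w - b *\<^sub>R z = c *\<^sub>R x"
    by (auto simp: span_breakdown_eq span_singleton)
  then show ?thesis using that[of a b c] by (simp add: algebra_simps)
qed

lemma eigenvalues_distinct:
  assumes p: "0 < p" "p < 1" and g: "eigenvalue_gap p x \<noteq> 0"
  shows "p * conic_u p x \<noteq> - (1 - p) * conic_v p x"
proof -
  have "eigenvalue_gap p x = p * conic_u p x - (- (1 - p) * conic_v p x)"
    using conic_eqs(2)[OF p, of x] by (simp add: algebra_simps)
  then show ?thesis
    using g by force
qed

text \<open>An eigenvector \<open>w\<close>, an eigenvector \<open>z\<close> of the other eigenvalue and \<open>x\<close> form an orthogonal basis, and every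
  further eigenvector of the first eigenvalue is orthogonal to \<open>z\<close> and \<open>x\<close>.\<close>
lemma eigenspace_eq_span:
  assumes p: "0 < p" "p < 1" and x: "x \<in> sphere 0 1" and g: "eigenvalue_gap p x \<noteq> 0"
    and w: "w \<in> eigenspace p x (p * conic_u p x)" "w \<noteq> 0"
  shows "eigenspace p x (p * conic_u p x) = span {w}"
proof
  show "span {w} \<subseteq> eigenspace p x (p * conic_u p x)"
    using w subspace_eigenspace by (simp add: span_minimal)
  note ne = eigenvalues_distinct[OF p g]
  obtain z where z: "z \<noteq> 0" "z \<in> eigenspace p x (- (1 - p) * conic_v p x)"
    using eigenvalue_iff[OF p x] by blast
  show "eigenspace p x (p * conic_u p x) \<subseteq> span {w}"
  proof
    fix v assume v: "v \<in> eigenspace p x (p * conic_u p x)"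
    have o: "w \<bullet> x = 0" "z \<bullet> x = 0" "v \<bullet> x = 0" using w z v by (simp_all add: eigenspace_def)
    have x0: "x \<noteq> 0" using x by auto
    have wz: "w \<bullet> z = 0" and vz: "v \<bullet> z = 0"
      using eigenspaces_orthogonal[OF _ z(2) ne] w v by blast+
    obtain a b c where e: "v = a *\<^sub>R w + b *\<^sub>R z + c *\<^sub>R x"
      by (rule orthogonal_triple_expand[OF x0 w(2) z(1) o(1,2) wz])
    have "v \<bullet> z = b * (z \<bullet> z)" "v \<bullet> x = c * (x \<bullet> x)"
      using o wz by (simp_all add: e inner_simps inner_commute)
    then have "b = 0" "c = 0" using vz o z x0 by simp_all
    then show "v \<in> span {w}" using e by (auto simp: span_singleton)
  qed
qed

definition tangential :: "real^3 \<Rightarrow> real^3 \<Rightarrow> real^3" where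
  "tangential x w = w - (w \<bullet> x) *\<^sub>R x"

text \<open>Subtracting the other eigenvalue \<open>- (1 - p) v\<close> from the restricted operator leaves a multiple of the
  projection onto the eigenline of \<open>p u\<close>. Applied to a fixed vector \<open>d\<close> this gives a continuous section of the
  line field that is nonzero near any point where \<open>d\<close> spans the line.\<close>
definition eigenfield :: "real \<Rightarrow> real^3 \<Rightarrow> real^3 \<Rightarrow> real^3" where
  "eigenfield p d x = tangential x (form_op p (tangential x d))
     + ((1 - p) * conic_v p x) *\<^sub>R tangential x d"

lemma eigenfield_in_eigenspace:
  assumes p: "0 < p" "p < 1" and x: "x \<in> sphere 0 1" and g: "eigenvalue_gap p x \<noteq> 0"
  shows "eigenfield p d x \<in> eigenspace p x (p * conic_u p x)"
    and "d \<in> eigenspace p x (p * conic_u p x) \<Longrightarrow> eigenfield p d x = eigenvalue_gap p x *\<^sub>R d"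
proof -
  note ne = eigenvalues_distinct[OF p g]
  have xx: "x \<bullet> x = 1" using x by (simp add: norm_eq_1)
  have x0: "x \<noteq> 0" using x by auto
  define \<nu> where "\<nu> = - (1 - p) * conic_v p x"
  obtain z where z: "z \<noteq> 0" "z \<in> eigenspace p x (- (1 - p) * conic_v p x)"
    using eigenvalue_iff[OF p x] by blast
  obtain t' where t': "form_op p z = \<nu> *\<^sub>R z + t' *\<^sub>R x" and zx: "z \<bullet> x = 0"
    using z by (auto simp: eigenspace_def \<nu>_def)
  have main: "eigenfield p (a *\<^sub>R w + b *\<^sub>R z + c *\<^sub>R x) x = (a * eigenvalue_gap p x) *\<^sub>R w"
    if w: "w \<in> eigenspace p x (p * conic_u p x)" for a b c w
  proof -
    obtain t where t: "form_op p w = (p * conic_u p x) *\<^sub>R w + t *\<^sub>R x" and wx: "w \<bullet> x = 0"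
      using w by (auto simp: eigenspace_def)
    have 1: "tangential x (a *\<^sub>R w + b *\<^sub>R z + c *\<^sub>R x) = a *\<^sub>R w + b *\<^sub>R z"
      using wx zx xx by (simp add: tangential_def inner_simps)
    have 2: "tangential x (form_op p (a *\<^sub>R w + b *\<^sub>R z)) = (a * (p * conic_u p x)) *\<^sub>R w + (b * \<nu>) *\<^sub>R z"
      using wx zx xx t t'
      by (simp add: tangential_def inner_simps linear_add[OF linear_form_op] linear_cmul[OF linear_form_op] algebra_simps)
    show ?thesis
      unfolding eigenfield_def 1 2 conic_eqs(2)[OF p] by (simp add: \<nu>_def algebra_simps)
  qed
  obtain w where w: "w \<noteq> 0" "w \<in> eigenspace p x (p * conic_u p x)"
    using eigenvalue_iff[OF p x] by blast
  have wx: "w \<bullet> x = 0" using w by (simp add: eigenspace_def)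
  have wz: "w \<bullet> z = 0" using eigenspaces_orthogonal[OF w(2) z(2) ne] .
  obtain a b c where "d = a *\<^sub>R w + b *\<^sub>R z + c *\<^sub>R x"
    by (rule orthogonal_triple_expand[OF x0 w(1) z(1) wx zx wz])
  then show "eigenfield p d x \<in> eigenspace p x (p * conic_u p x)"
    using main[OF w(2)] w(2) subspace_eigenspace by (metis subspace_scale)
  show "eigenfield p d x = eigenvalue_gap p x *\<^sub>R d" if "d \<in> eigenspace p x (p * conic_u p x)"
    using main[OF that, of 1 0 0] by simp
qed

lemma continuous_on_eigenfield: "continuous_on S (eigenfield p d)"
proof -
  have t: "continuous_on S (form_op p \<circ> f)" if "continuous_on S f" for f
    by (rule continuous_on_compose[OF that]) (rule linear_continuous_on[OF linear_conv_bounded_linear[THEN iffD1, OF linear_form_op]])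
  have "continuous_on S (\<lambda>x. form_op p (d - (d \<bullet> x) *\<^sub>R x))"
    by (rule t[unfolded comp_def]) (intro continuous_intros)
  then show ?thesis
    unfolding eigenfield_def tangential_def by (intro continuous_intros)
qed

lemma flip_eigenspace: "flip ` eigenspace (1 - p) (flip x) \<nu> = eigenspace p x (- \<nu>)"
proof -
  have flip: "flip w \<in> eigenspace (1 - p) (flip x) \<nu>" if w: "w \<in> eigenspace p x \<mu>" and \<mu>: "\<mu> = - \<nu>"
    for w p x \<mu> \<nu>
  proof -
    obtain t where t: "form_op p w = \<mu> *\<^sub>R w + t *\<^sub>R x" "w \<bullet> x = 0"
      using w unfolding eigenspace_def by blast
    have "form_op (1 - p) (flip w) = \<nu> *\<^sub>R flip w + (- t) *\<^sub>R flip x"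
      using t(1) \<mu> by (simp add: vec_eq_iff forall_3 algebra_simps)
    moreover have "flip w \<bullet> flip x = 0" using t(2) by (simp add: inner_real3)
    ultimately show ?thesis unfolding eigenspace_def by blast
  qed
  show ?thesis
  proof
    show "flip ` eigenspace (1 - p) (flip x) \<nu> \<subseteq> eigenspace p x (- \<nu>)"
      using flip[of _ "1 - p" "flip x" \<nu> "- \<nu>"] by auto
    show "eigenspace p x (- \<nu>) \<subseteq> flip ` eigenspace (1 - p) (flip x) \<nu>"
      using flip[of _ p x "- \<nu>" \<nu>] by (auto simp: image_iff intro!: bexI[of _ "flip _"])
  qed
qed

section \<open>The leaves on the sphere\<close>

definition nonumbilic :: "real \<Rightarrow> (real^3) set" where
  "nonumbilic p = {x \<in> sphere 0 1. eigenvalue_gap p x \<noteq> 0}"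

text \<open>The level sets of \<open>v\<close> consist of two closed curves or arcs, distinguished by the sign of \<open>x\<^sub>3\<close>, except for \<open>v = 1\<close>:
  that level is the single curve \<open>x\<^sub>3 = 0\<close>.\<close>
definition leaf_label :: "real \<Rightarrow> real^3 \<Rightarrow> real \<times> real" where
  "leaf_label p x = (conic_v p x, sgn (x$3))"

definition first_line :: "real \<Rightarrow> real^3 \<Rightarrow> (real^3) set" where
  "first_line p x = eigenspace p x (p * conic_u p x)"

lemma nonumbilicD:
  assumes "x \<in> nonumbilic p"
  shows "x \<in> sphere 0 1" "eigenvalue_gap p x \<noteq> 0"
  using assms by (auto simp: nonumbilic_def)

lemma eigenvalue_gap_pos: "0 < p \<Longrightarrow> p < 1 \<Longrightarrow> x \<in> nonumbilic p \<Longrightarrow> 0 < eigenvalue_gap p x"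
  by (auto simp: nonumbilic_def eigenvalue_gap_def less_le)

text \<open>This says that \<open>v\<close> has derivative zero along an eigenvector \<open>w\<close> of \<open>p u\<close>, in a form without division by the
  gap. With \<open>Q\<close> for the operator and \<open>t\<close> for the normal component of \<open>Q w\<close>, one has \<open>t = \<langle>Q x, w\<rangle>\<close>, and
  the Cayley-Hamilton identity \<open>adj Q = Q\<^sup>2 - (tr Q) Q - p (1 - p)\<close> evaluated on \<open>x\<close> and \<open>w\<close> gives
  \<open>- p (1 - p) x\<^sub>2 w\<^sub>2 = (1 - p) v t\<close>.\<close>
lemma first_line_derivative:
  assumes p: "0 < p" "p < 1" and x: "x \<in> sphere 0 1"
    and w: "w \<in> first_line p x"
  shows "p * x$2 * w$2 = conic_v p x * ((1 - p) * x$3 * w$3 - p * x$1 * w$1)"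
proof -
  define u v where "u = conic_u p x" and "v = conic_v p x"
  obtain t where wx: "w \<bullet> x = 0" and tw: "form_op p w = (p * u) *\<^sub>R w + t *\<^sub>R x"
    using w by (auto simp: first_line_def eigenspace_def u_def)
  have t: "p * w$1 = p * u * w$1 + t * x$1" "0 = p * u * w$2 + t * x$2"
      "- ((1 - p) * w$3) = p * u * w$3 + t * x$3"
    using arg_cong[OF tw, of "\<lambda>z. z$1"] arg_cong[OF tw, of "\<lambda>z. z$2"]
      arg_cong[OF tw, of "\<lambda>z. z$3"] by simp_all
  have s: "(x$1)\<^sup>2 + (x$2)\<^sup>2 + (x$3)\<^sup>2 = 1"
    using x by (simp only: in_sphere_iff)
  have wx': "w$1 * x$1 + w$2 * x$2 + w$3 * x$3 = 0"
    using wx by (simp add: inner_real3)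
  have tr: "p * (1 - (x$1)\<^sup>2) - (1 - p) * (1 - (x$3)\<^sup>2) = p * u - (1 - p) * v"
    using conic_eqs(1)[OF p, of x] by (simp add: eigenvalue_sum_def u_def v_def)
  have tq: "t = p * x$1 * w$1 - (1 - p) * x$3 * w$3"
  proof -
    have "t = t * ((x$1)\<^sup>2 + (x$2)\<^sup>2 + (x$3)\<^sup>2)"
      using s by simp
    also have "\<dots> = x$1 * (t * x$1) + x$2 * (t * x$2) + x$3 * (t * x$3)"
      by (simp add: power2_eq_square algebra_simps)
    also have "\<dots> = x$1 * (p * w$1 - p * u * w$1) + x$2 * (- (p * u * w$2))
        + x$3 * (- ((1 - p) * w$3) - p * u * w$3)"
      using t by (simp add: add_eq_0_iff)
    also have "\<dots> = p * x$1 * w$1 - (1 - p) * x$3 * w$3 - p * u * (w$1 * x$1 + w$2 * x$2 + w$3 * x$3)"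
      by (simp add: algebra_simps)
    finally show ?thesis using wx' by simp
  qed
  have "- p * (1 - p) * x$2 * w$2
      = p * x$1 * (p * w$1) - (1 - p) * x$3 * ((1 - p) * w$3)
         + 2 * (1 - p) * x$3 * ((1 - p) * w$3)
         - (2 * p - 1) * (p * x$1 * w$1 - (1 - p) * x$3 * w$3)
         - p * (1 - p) * (w$1 * x$1 + w$2 * x$2 + w$3 * x$3)"
    by (simp add: algebra_simps)
  also have "\<dots> = p * x$1 * (p * w$1) - (1 - p) * x$3 * (- ((1 - p) * w$3)) - (2 * p - 1) * t"
    unfolding wx' tq[symmetric] by (simp add: algebra_simps)
  also have "\<dots> = p * u * (p * x$1 * w$1 - (1 - p) * x$3 * w$3)
      + t * (p * (x$1)\<^sup>2 - (1 - p) * (x$3)\<^sup>2 - (2 * p - 1))"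
    by (simp only: t(1) t(3)) (simp add: power2_eq_square algebra_simps)
  also have "\<dots> = t * (p * u + (p * (x$1)\<^sup>2 - (1 - p) * (x$3)\<^sup>2 - (2 * p - 1)))"
    unfolding tq[symmetric] by (simp add: algebra_simps)
  also have "p * u + (p * (x$1)\<^sup>2 - (1 - p) * (x$3)\<^sup>2 - (2 * p - 1)) = (1 - p) * v"
    using tr by (simp add: algebra_simps)
  finally have "(1 - p) * (p * x$2 * w$2) = (1 - p) * (v * ((1 - p) * x$3 * w$3 - p * x$1 * w$1))"
    unfolding tq by (simp add: algebra_simps)
  then show ?thesis using p by (simp add: v_def)
qed

lemma conic_v_constant_along_first_line:
  fixes x w :: "real \<Rightarrow> real^3"
  assumes p: "0 < p" "p < 1" and I: "is_interval I" "open I"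
    and x: "\<And>t. t \<in> I \<Longrightarrow> x t \<in> nonumbilic p"
    and d: "\<And>t. t \<in> I \<Longrightarrow> (x has_vector_derivative w t) (at t)"
    and w: "\<And>t. t \<in> I \<Longrightarrow> w t \<in> first_line p (x t)"
    and st: "s \<in> I" "t \<in> I"
  shows "conic_v p (x s) = conic_v p (x t)"
proof -
  have "((\<lambda>t. conic_v p (x t)) has_real_derivative 0) (at t)" if t: "t \<in> I" for t
  proof -
    have xs: "x t \<in> sphere 0 1" and g: "0 < eigenvalue_gap p (x t)"
      using x[OF t] eigenvalue_gap_pos[OF p x[OF t]] by (simp_all add: nonumbilic_def)
    have di: "((\<lambda>t. x t $ i) has_real_derivative w t $ i) (at t)" for i
      using bounded_linear.has_vector_derivative[OF bounded_linear_vec_nth d[OF t], of i]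
      by (simp add: has_real_derivative_iff_has_vector_derivative)
    define s' where "s' = 2 * (1 - p) * x t $ 3 * w t $ 3 - 2 * p * x t $ 1 * w t $ 1"
    have ds: "((\<lambda>t. eigenvalue_sum p (x t)) has_real_derivative s') (at t)"
      unfolding eigenvalue_sum_def s'_def by (auto intro!: derivative_eq_intros di simp: algebra_simps)
    define r' where "r' = (eigenvalue_sum p (x t) * s' + 4 * p * (1 - p) * x t $ 2 * w t $ 2) / eigenvalue_gap p (x t)"
    have pos: "0 < (eigenvalue_sum p (x t))\<^sup>2 + 4 * p * (1 - p) * (x t $ 2)\<^sup>2"
      using g by (simp add: eigenvalue_gap_def)
    have dg: "((\<lambda>t. eigenvalue_gap p (x t)) has_real_derivative r') (at t)"
      unfolding eigenvalue_gap_def r'_def using pos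
      by (auto intro!: derivative_eq_intros di ds simp: field_simps)
    have "eigenvalue_gap p (x t) * r' = eigenvalue_gap p (x t) * s'"
    proof -
      have "eigenvalue_gap p (x t) * r' = eigenvalue_sum p (x t) * s' + 4 * (1 - p) * (p * x t $ 2 * w t $ 2)"
        using g by (simp add: r'_def)
      also have "\<dots> = (eigenvalue_sum p (x t) + 2 * (1 - p) * conic_v p (x t)) * s'"
        unfolding first_line_derivative[OF p xs w[OF t]] s'_def by (simp add: algebra_simps)
      also have "\<dots> = eigenvalue_gap p (x t) * s'"
        unfolding conic_eqs[OF p] by (simp add: algebra_simps)
      finally show ?thesis .
    qed
    then have "r' = s'" using g by simp
    then show ?thesis
      unfolding conic_v_def using DERIV_cdivide[OF DERIV_diff[OF dg ds], of "2 * (1 - p)"] by simp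
  qed
  moreover have "connected I" using I(1) by (simp add: is_interval_connected_1)
  moreover from calculation(1) have "continuous_on I (\<lambda>t. conic_v p (x t))"
    by (intro continuous_at_imp_continuous_on ballI DERIV_isCont) blast
  ultimately obtain c where "\<And>t. t \<in> I \<Longrightarrow> conic_v p (x t) = c"
    using DERIV_zero_connected_constant[of I "{}" "\<lambda>t. conic_v p (x t)"] I(2) by auto
  then show ?thesis using st by simp
qed

lemma sgn_constant_on_connected:
  fixes f :: "'a::topological_space \<Rightarrow> real"
  assumes "connected I" "continuous_on I f" "\<And>t. t \<in> I \<Longrightarrow> f t \<noteq> 0" "s \<in> I" "t \<in> I"
  shows "sgn (f s) = sgn (f t)"
proof (rule ccontr)
  assume ne: "sgn (f s) \<noteq> sgn (f t)"
  have "connected (f ` I)" using assms by (intro connected_continuous_image)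
  then have "0 \<in> f ` I"
    using ne assms(3)[OF assms(4)] assms(3)[OF assms(5)] assms(4,5)
      connectedD_interval[of "f ` I" "f s" "f t" 0] connectedD_interval[of "f ` I" "f t" "f s" 0]
    by (auto simp: sgn_if split: if_splits)
  then show False using assms(3) by auto
qed

text \<open>For \<open>v \<noteq> 1\<close> the formula for \<open>x\<^sub>3\<^sup>2\<close> shows that \<open>x\<^sub>3\<close> does not vanish, so its sign cannot change along the
  curve.\<close>
lemma leaf_label_constant_along_first_line:
  fixes x w :: "real \<Rightarrow> real^3"
  assumes p: "0 < p" "p < 1" and I: "is_interval I" "open I"
    and x: "\<And>t. t \<in> I \<Longrightarrow> x t \<in> nonumbilic p"
    and d: "\<And>t. t \<in> I \<Longrightarrow> (x has_vector_derivative w t) (at t)"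
    and w: "\<And>t. t \<in> I \<Longrightarrow> w t \<in> first_line p (x t)"
    and st: "s \<in> I" "t \<in> I"
  shows "leaf_label p (x s) = leaf_label p (x t)"
proof -
  have v: "conic_v p (x s') = conic_v p (x t)" if "s' \<in> I" for s'
    using conic_v_constant_along_first_line[where x=x and w=w, OF p I _ _ _ that st(2)] x d w by metis
  have sq: "(x s' $ 3)\<^sup>2 = (1 - conic_v p (x t)) * (1 - p + p * conic_u p (x s'))" if "s' \<in> I" for s'
    using sq13_conic(2)[OF p, of "x s'"] x[OF that] unfolding v[OF that] nonumbilic_def by blast
  have "sgn (x s $ 3) = sgn (x t $ 3)"
  proof (cases "conic_v p (x t) = 1")
    case True
    then have "x s $ 3 = 0" "x t $ 3 = 0" using sq[OF st(1)] sq[OF st(2)] by simp_all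
    then show ?thesis by simp
  next
    case False
    have "x s' $ 3 \<noteq> 0" if "s' \<in> I" for s'
    proof -
      have "0 < 1 - p + p * conic_u p (x s')"
        using conic_nonneg(1)[OF p] p by (simp add: add_pos_nonneg)
      then show ?thesis using sq[OF that] False by auto
    qed
    moreover have "continuous_on I (\<lambda>t. x t $ 3)"
      by (intro continuous_on_component continuous_at_imp_continuous_on ballI)
        (rule has_vector_derivative_continuous[OF d])
    ultimately show ?thesis
      using sgn_constant_on_connected[of I "\<lambda>t. x t $ 3", OF _ _ _ st] I(1)
      unfolding is_interval_connected_1 by blast
  qed
  then show ?thesis using v[OF st(1)] by (simp add: leaf_label_def)
qed

text \<open>On a fibre \<open>v\<close> is fixed and \<open>u = sin\<^sup>2 t\<close> serves as parameter: the three formulas then read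
  \<open>x = (X cos t, Y sin t, Z sqrt (1 - p + p sin\<^sup>2 t))\<close>. For \<open>v > 0\<close> this is a closed curve, traced infinitely often;
  for \<open>v = 0\<close> it is an arc whose end points, at \<open>sin t = 0\<close>, are umbilics.\<close>
lemma leaf_curve:
  assumes p: "0 < p" "p < 1" and x0: "x0 \<in> nonumbilic p"
  obtains I x w where "I \<noteq> {}" "open I" "is_interval (I :: real set)"
    "x ` I = {y \<in> nonumbilic p. leaf_label p y = leaf_label p x0}"
    "continuous_on I w"
    "\<forall>t\<in>I. (x has_vector_derivative w t) (at t) \<and> w t \<noteq> 0 \<and> w t \<in> first_line p (x t)"
proof -
  define v where "v = conic_v p x0"
  define \<sigma> where "\<sigma> = sgn (x0$3)"
  have x0s: "x0 \<in> sphere 0 1" using x0 by (simp add: nonumbilic_def)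
  have v01: "0 \<le> v" "v \<le> 1" using conic_nonneg(2)[OF p] conic_le_1[OF p x0s] by (simp_all add: v_def)
  have \<sigma>: "\<sigma>\<^sup>2 * (1 - v) = 1 - v"
  proof (cases "x0$3 = 0")
    case True
    have "0 < 1 - p + p * conic_u p x0"
      using conic_nonneg(1)[OF p] p by (simp add: add_pos_nonneg)
    then have "v = 1" using sq13_conic(2)[OF p x0s] True by (simp add: v_def)
    then show ?thesis by simp
  qed (simp add: \<sigma>_def sgn_if)
  define X where "X = sqrt (p + (1 - p) * v)"
  define Y where "Y = sqrt v"
  define Z where "Z = \<sigma> * sqrt (1 - v)"
  define R where "R t = sqrt (1 - p + p * (sin t)\<^sup>2)" for t
  have Xpos: "0 < X" using p v01 by (simp add: X_def add_pos_nonneg)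
  have sq: "X\<^sup>2 = p + (1 - p) * v" "Y\<^sup>2 = v" "Z\<^sup>2 = 1 - v"
    using p v01 \<sigma> by (simp_all add: X_def Y_def Z_def power_mult_distrib)
  have Rpos: "0 < 1 - p + p * (sin t)\<^sup>2" "0 < R t" for t
    using p by (simp_all add: R_def add_pos_nonneg)
  have Rsq: "(R t)\<^sup>2 = 1 - p + p * (sin t)\<^sup>2" for t
    using Rpos(1)[of t] by (simp add: R_def)
  \<comment> \<open>At \<open>v = 0\<close> the curve passes through umbilics whenever \<open>sin t = 0\<close>.\<close>
  define I where "I = (if v = 0 then {0<..<pi} else UNIV)"
  define x :: "real \<Rightarrow> real^3" where "x t = vector [X * cos t, Y * sin t, Z * R t]" for t
  define w :: "real \<Rightarrow> real^3" where
    "w t = vector [- X * sin t, Y * cos t, Z * (p * sin t * cos t / R t)]" for t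
  have I: "I \<noteq> {}" "open I" "is_interval I"
    by (simp_all add: I_def is_interval_oo not_le)
  have xu: "x t \<in> sphere 0 1" "conic_u p (x t) = (sin t)\<^sup>2" "conic_v p (x t) = v" for t
  proof -
    have "(x t $ 1)\<^sup>2 = (1 - (sin t)\<^sup>2) * (p + (1 - p) * v)" "(x t $ 2)\<^sup>2 = (sin t)\<^sup>2 * v"
      "(x t $ 3)\<^sup>2 = (1 - v) * (1 - p + p * (sin t)\<^sup>2)"
      by (simp_all add: x_def power_mult_distrib sq Rsq cos_squared_eq)
    from conic_unique[OF p _ v01(1) this]
    show "x t \<in> sphere 0 1" "conic_u p (x t) = (sin t)\<^sup>2" "conic_v p (x t) = v"
      by simp_all
  qed
  have xn: "x t \<in> nonumbilic p" if "t \<in> I" for t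
  proof -
    have "0 < v \<or> 0 < (sin t)\<^sup>2" using that v01 sin_gt_zero[of t] by (auto simp: I_def split: if_splits)
    then have "0 < p * (sin t)\<^sup>2 + (1 - p) * v"
      using p v01 by (auto intro: add_pos_nonneg add_nonneg_pos)
    then show ?thesis using xu[of t] conic_eqs(2)[OF p, of "x t"] by (simp add: nonumbilic_def)
  qed
  have xl: "leaf_label p (x t) = leaf_label p x0" for t
  proof -
    have "sgn (x t $ 3) = \<sigma>"
    proof (cases "v = 1")
      case True
      have "x0 $ 3 = 0" using sq13_conic(2)[OF p x0s] True by (simp add: v_def)
      then show ?thesis by (simp add: x_def Z_def \<sigma>_def)
    next
      case False
      then show ?thesis using v01 Rpos(2)[of t] by (simp add: x_def Z_def sgn_mult \<sigma>_def)
    qed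
    then show ?thesis using xu(3)[of t] by (simp add: leaf_label_def v_def \<sigma>_def)
  qed
  have onto: "\<exists>t\<in>I. y = x t" if y: "y \<in> nonumbilic p" "leaf_label p y = leaf_label p x0" for y
  proof -
    have ys: "y \<in> sphere 0 1" and vy: "conic_v p y = v" and sy: "sgn (y$3) = \<sigma>"
      using y by (simp_all add: nonumbilic_def leaf_label_def v_def \<sigma>_def)
    define u where "u = conic_u p y"
    have u: "0 \<le> u" "u \<le> 1" using conic_nonneg[OF p, of y] conic_le_1[OF p ys] by (simp_all add: u_def)
    have y1: "(y$1)\<^sup>2 = (1 - u) * (p + (1 - p) * v)" and y2: "(y$2)\<^sup>2 = u * v"
      and y3: "(y$3)\<^sup>2 = (1 - v) * (1 - p + p * u)"
      using sq13_conic[OF p ys] sq2_conic[OF p, of y] by (simp_all add: u_def vy)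
    have y1': "(y$1 / X)\<^sup>2 = 1 - u"
      using y1 sq(1)[symmetric] Xpos by (simp add: power_divide)
    obtain t where t: "t \<in> I" "y$1 = X * cos t" "y$2 = Y * sin t"
    proof (cases "v = 0")
      case True
      have "u \<noteq> 0"
        using y(1) True vy conic_eqs(2)[OF p, of y] by (auto simp: nonumbilic_def u_def)
      then have "(y$1 / X)\<^sup>2 < 1\<^sup>2" using y1' u by simp
      then have "\<bar>y$1 / X\<bar> < 1" by (metis abs_1 abs_le_square_iff linorder_not_le abs_ge_zero power2_abs abs_square_less_1 one_power2)
      then have c: "-1 < y$1 / X" "y$1 / X < 1" by linarith+
      have "arccos (y$1 / X) \<in> I" using c True by (simp add: I_def arccos_lt_bounded)
      moreover have "y$1 = X * cos (arccos (y$1 / X))" using c Xpos by simp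
      moreover have "y$2 = Y * sin (arccos (y$1 / X))" using y2 True by (simp add: Y_def)
      ultimately show ?thesis by (rule that)
    next
      case False
      then have Y: "Y \<noteq> 0" by (simp add: Y_def)
      have "(y$1 / X)\<^sup>2 + (y$2 / Y)\<^sup>2 = 1"
        using y1' y2 sq(2) False by (simp add: power_divide)
      then obtain t where "y$1 / X = cos t" "y$2 / Y = sin t"
        using sincos_total_2pi by metis
      then show ?thesis using that[of t] Xpos Y False by (simp add: I_def field_simps)
    qed
    have "X\<^sup>2 * (cos t)\<^sup>2 = X\<^sup>2 * (1 - u)"
      using y1 t(2) by (simp add: power_mult_distrib sq mult.commute)
    then have su: "(sin t)\<^sup>2 = u" using Xpos by (simp add: sin_squared_eq)
    have "\<bar>y$3\<bar> = sqrt (1 - v) * R t"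
      using y3 by (metis R_def su real_sqrt_abs real_sqrt_mult)
    then have "y$3 = Z * R t"
      using sgn_mult_abs[of "y$3"] sy by (simp add: Z_def mult.assoc)
    then show ?thesis using t by (intro bexI[of _ t]) (simp_all add: x_def vec_eq_iff forall_3)
  qed
  have "x ` I = {y \<in> nonumbilic p. leaf_label p y = leaf_label p x0}"
    using xn xl onto by fastforce
  moreover have "continuous_on I w"
  proof -
    have "continuous_on I (\<lambda>t. w t $ i)" for i
    proof -
      have "R t \<noteq> 0" for t using Rpos(2)[of t] by simp
      then have "continuous_on I (\<lambda>t. w t $ 1)" "continuous_on I (\<lambda>t. w t $ 2)" "continuous_on I (\<lambda>t. w t $ 3)"
        unfolding w_def vector_3 R_def by (auto intro!: continuous_intros)
      then show ?thesis using exhaust_3[of i] by auto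
    qed
    then show ?thesis by (rule continuous_on_vec_lambda[of I "\<lambda>i t. w t $ i", simplified])
  qed
  moreover have "\<forall>t\<in>I. (x has_vector_derivative w t) (at t) \<and> w t \<noteq> 0 \<and> w t \<in> first_line p (x t)"
  proof (intro ballI conjI)
    fix t assume t: "t \<in> I"
    have "((\<lambda>t. x t $ i) has_real_derivative w t $ i) (at t)" for i
    proof -
      have "((\<lambda>t. x t $ 1) has_real_derivative w t $ 1) (at t)"
        "((\<lambda>t. x t $ 2) has_real_derivative w t $ 2) (at t)"
        unfolding x_def w_def by (auto intro!: derivative_eq_intros)
      moreover have "(R has_real_derivative p * sin t * cos t / R t) (at t)"
        unfolding R_def using Rpos(1)[of t] by (auto intro!: derivative_eq_intros simp: field_simps)
      then have "((\<lambda>t. x t $ 3) has_real_derivative w t $ 3) (at t)"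
        unfolding x_def w_def vector_3 by (rule DERIV_cmult)
      ultimately show ?thesis using exhaust_3[of i] by auto
    qed
    then show "(x has_vector_derivative w t) (at t)"
      unfolding has_vector_derivative_def has_derivative_componentwise_within[of x]
        has_real_derivative_iff_has_vector_derivative
      by (auto simp: Basis_vec_def inner_axis has_vector_derivative_def)
    show "w t \<noteq> 0"
    proof
      assume "w t = 0"
      then have "X * sin t = 0" "Y * cos t = 0" by (simp_all add: w_def vec_eq_iff forall_3)
      then have s: "sin t = 0" "Y = 0" using Xpos sin_zero_norm_cos_one[of t] by auto
      then have "v = 0" using sq(2) by simp
      then show False using t s(1) sin_gt_zero[of t] by (simp add: I_def)
    qed
    have c2: "(cos t)\<^sup>2 = 1 - (sin t)\<^sup>2" by (rule cos_squared_eq)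
    have RR: "R t * (p * sin t * cos t / R t) = p * sin t * cos t" using Rpos(2)[of t] by simp
    have "w t \<bullet> x t = - X\<^sup>2 * (sin t * cos t) + Y\<^sup>2 * (sin t * cos t) + Z\<^sup>2 * (R t * (p * sin t * cos t / R t))"
      by (simp add: inner_real3 x_def w_def power2_eq_square algebra_simps)
    also have "\<dots> = 0"
      unfolding RR sq by (simp add: algebra_simps)
    finally have wx: "w t \<bullet> x t = 0" .
    have "form_op p (w t) = (p * (sin t)\<^sup>2) *\<^sub>R w t + (- p * sin t * cos t) *\<^sub>R x t"
    proof -
      have "p * (- X * sin t) = p * (sin t)\<^sup>2 * (- X * sin t) + (- p * sin t * cos t) * (X * cos t)"
        using c2 by algebra
      moreover have "0 = p * (sin t)\<^sup>2 * (Y * cos t) + (- p * sin t * cos t) * (Y * sin t)"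
        by algebra
      moreover have "- ((1 - p) * (Z * (p * sin t * cos t / R t)))
         = p * (sin t)\<^sup>2 * (Z * (p * sin t * cos t / R t)) + (- p * sin t * cos t) * (Z * R t)"
      proof -
        have "(R t)\<^sup>2 * (Z * (p * sin t * cos t / R t)) = p * sin t * cos t * (Z * R t)"
          using Rpos(2)[of t] by (simp add: power2_eq_square)
        moreover have "- ((1 - p) * q) = b * q + (- c) * d"
          if "(1 - p + b) * q = c * d" for b q c d
          using that by (simp add: algebra_simps)
        ultimately show ?thesis
          unfolding Rsq by (metis mult_minus_left)
      qed
      ultimately show ?thesis
        by (simp add: vec_eq_iff forall_3 w_def x_def)
    qed
    then show "w t \<in> first_line p (x t)"
      unfolding first_line_def eigenspace_def xu using wx by blast
  qed
  ultimately show ?thesis by (rule that[OF I])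
qed

section \<open>Foliations as fibres of a first integral\<close>

text \<open>If every integral curve stays in a fibre and every fibre is itself a trace, then the maximal traces are
  exactly the fibres.\<close>
lemma foliation_fibres:
  assumes inv: "\<And>I \<gamma> s t. integral_curve R D I \<gamma> \<Longrightarrow> s \<in> I \<Longrightarrow> t \<in> I \<Longrightarrow> lab (\<gamma> s) = lab (\<gamma> t)"
    and tr: "\<And>q. q \<in> R \<Longrightarrow> {q' \<in> R. lab q' = lab q} \<in> integral_traces R D"
  shows "foliation R D = (\<lambda>q. {q' \<in> R. lab q' = lab q}) ` R"
proof -
  have sub: "\<exists>q\<in>R. C \<subseteq> {q' \<in> R. lab q' = lab q} \<and> q \<in> C" if C0: "C \<in> integral_traces R D" for C
  proof -
    obtain I \<gamma> where C: "C = \<gamma> ` I" and c: "integral_curve R D I \<gamma>"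
      using C0 unfolding integral_traces_def by blast
    then obtain t where t: "t \<in> I" and R: "\<gamma> ` I \<subseteq> R" by (auto simp: integral_curve_def)
    have "C \<subseteq> {q' \<in> R. lab q' = lab (\<gamma> t)}"
      unfolding C using inv[OF c _ t] R by blast
    then show ?thesis using t R C by blast
  qed
  show ?thesis
  proof (intro equalityI subsetI)
    fix C assume "C \<in> foliation R D"
    then have C: "C \<in> integral_traces R D" and m: "\<And>C'. C' \<in> integral_traces R D \<Longrightarrow> C \<subseteq> C' \<Longrightarrow> C' = C"
      by (auto simp: foliation_def)
    then show "C \<in> (\<lambda>q. {q' \<in> R. lab q' = lab q}) ` R"
      using sub[OF C] m tr by blast
  next
    fix C assume "C \<in> (\<lambda>q. {q' \<in> R. lab q' = lab q}) ` R"
    then obtain q where q: "q \<in> R" and C: "C = {q' \<in> R. lab q' = lab q}" by blast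
    have "C' = C" if C': "C' \<in> integral_traces R D" "C \<subseteq> C'" for C'
    proof -
      obtain r where r: "r \<in> R" "C' \<subseteq> {q' \<in> R. lab q' = lab r}" using sub[OF C'(1)] by blast
      have "q \<in> C'" using q C C'(2) by blast
      then have "lab q = lab r" using r by blast
      then show ?thesis using r C C'(2) by auto
    qed
    then show "C \<in> foliation R D"
      using tr[OF q] C by (auto simp: foliation_def)
  qed
qed

lemma foliation_first_line:
  assumes p: "0 < p" "p < 1" and L: "linear L" "inj L"
    and R: "R = (\<lambda>x. o' + L x) ` nonumbilic p"
    and D: "\<And>x. x \<in> nonumbilic p \<Longrightarrow> D (o' + L x) = L ` first_line p x"
  shows "foliation R D = (\<lambda>x. (\<lambda>y. o' + L y) ` {y \<in> nonumbilic p. leaf_label p y = leaf_label p x}) ` nonumbilic p"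
proof -
  obtain G where G: "linear G" "\<And>x. G (L x) = x"
    using linear_injective_left_inverse[OF L] by (auto simp: fun_eq_iff)
  define lab where "lab q = leaf_label p (G (q - o'))" for q
  have lab: "lab (o' + L x) = leaf_label p x" for x by (simp add: lab_def G)
  have fib: "{q' \<in> R. lab q' = lab (o' + L x)} = (\<lambda>y. o' + L y) ` {y \<in> nonumbilic p. leaf_label p y = leaf_label p x}" for x
    unfolding R lab by (auto simp: lab)
  have bG: "bounded_linear G" and bL: "bounded_linear L"
    using G(1) L(1) by (simp_all add: linear_conv_bounded_linear)
  have "foliation R D = (\<lambda>q. {q' \<in> R. lab q' = lab q}) ` R"
  proof (rule foliation_fibres)
    fix I \<gamma> s t assume c: "integral_curve R D I \<gamma>" and st: "s \<in> I" "t \<in> I"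
    then obtain \<gamma>' where I: "is_interval I" "open I" and gR: "\<gamma> ` I \<subseteq> R" and
      g: "\<And>t. t \<in> I \<Longrightarrow> (\<gamma> has_vector_derivative \<gamma>' t) (at t)" "\<And>t. t \<in> I \<Longrightarrow> \<gamma>' t \<in> D (\<gamma> t)"
      by (auto simp: integral_curve_def)
    define x where "x t = G (\<gamma> t - o')" for t
    have x: "x t \<in> nonumbilic p \<and> \<gamma> t = o' + L (x t)" if "t \<in> I" for t
      using gR that unfolding R x_def by (auto simp: image_subset_iff G)
    have d: "(x has_vector_derivative G (\<gamma>' t)) (at t)" if "t \<in> I" for t
      using bounded_linear.has_vector_derivative[OF bG has_vector_derivative_diff[OF g(1)[OF that] has_vector_derivative_const[of o']]]
      unfolding x_def by simp
    have w: "G (\<gamma>' t) \<in> first_line p (x t)" if "t \<in> I" for t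
    proof -
      have "\<gamma>' t \<in> L ` first_line p (x t)" using g(2)[OF that] D x[OF that] by metis
      then show ?thesis using G by auto
    qed
    have "leaf_label p (x s) = leaf_label p (x t)"
      by (rule leaf_label_constant_along_first_line[where x=x and w="\<lambda>t. G (\<gamma>' t)" and I=I])
        (use p I x d w st in blast)+
    then show "lab (\<gamma> s) = lab (\<gamma> t)" by (simp add: lab_def x_def)
  next
    fix q assume "q \<in> R"
    then obtain x0 where x0: "x0 \<in> nonumbilic p" "q = o' + L x0" by (auto simp: R)
    obtain I x w where I: "I \<noteq> {}" "open I" "is_interval (I :: real set)" and
      xI: "x ` I = {y \<in> nonumbilic p. leaf_label p y = leaf_label p x0}" and cw: "continuous_on I w" and
      d: "\<And>t. t \<in> I \<Longrightarrow> (x has_vector_derivative w t) (at t) \<and> w t \<noteq> 0 \<and> w t \<in> first_line p (x t)"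
      by (rule leaf_curve[OF p x0(1)]) blast
    have xn: "x t \<in> nonumbilic p" if "t \<in> I" for t using xI that by blast
    have "integral_curve R D I (\<lambda>t. o' + L (x t))"
      unfolding integral_curve_def
    proof (intro conjI I exI[of _ "\<lambda>t. L (w t)"] ballI)
      show "(\<lambda>t. o' + L (x t)) ` I \<subseteq> R" using xn by (auto simp: R)
      show "continuous_on I (\<lambda>t. L (w t))" by (rule bounded_linear.continuous_on[OF bL cw])
      fix t assume t: "t \<in> I"
      show "((\<lambda>t. o' + L (x t)) has_vector_derivative L (w t)) (at t)"
        using has_vector_derivative_add[OF has_vector_derivative_const[of o'] bounded_linear.has_vector_derivative[OF bL]] d[OF t]
        by (metis add_0)
      show "L (w t) \<noteq> 0" using d[OF t] G by (metis linear_0[OF G(1)])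
      show "L (w t) \<in> D (o' + L (x t))" using D[OF xn[OF t]] d[OF t] by auto
    qed
    moreover have "(\<lambda>t. o' + L (x t)) ` I = {q' \<in> R. lab q' = lab q}"
      unfolding x0(2) fib xI[symmetric] by (auto simp: image_image)
    ultimately show "{q' \<in> R. lab q' = lab q} \<in> integral_traces R D"
      unfolding integral_traces_def by (auto intro: sym)
  qed
  then show ?thesis
    unfolding R image_image fib[unfolded R] .
qed

section \<open>Geographic charts of an ellipsoid\<close>

text \<open>A family of maps that contains the geographic charts and is closed under both partial derivatives, so that
  smoothness follows by induction on the order.\<close>
definition trig_map :: "real^3 \<Rightarrow> real^3 \<Rightarrow> real^3 \<Rightarrow> real^3 \<Rightarrow> real^3 \<Rightarrow> real^3 \<Rightarrow> real^3 \<Rightarrow> real \<times> real \<Rightarrow> real^3" where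
  "trig_map c0 c1 c2 c3 c4 c5 c6 = (\<lambda>(u, v). c0 + (cos u * cos v) *\<^sub>R c1 + (cos u * sin v) *\<^sub>R c2
     + (sin u * cos v) *\<^sub>R c3 + (sin u * sin v) *\<^sub>R c4 + cos u *\<^sub>R c5 + sin u *\<^sub>R c6)"

lemma trig_map_has_derivative:
  "(trig_map c0 c1 c2 c3 c4 c5 c6 has_derivative
     (\<lambda>h. fst h *\<^sub>R trig_map 0 c3 c4 (- c1) (- c2) c6 (- c5) q
        + snd h *\<^sub>R trig_map 0 c2 (- c1) c4 (- c3) 0 0 q)) (at q)"
proof -
  have prod: "((\<lambda>q. (f (fst q) * g (snd q)) *\<^sub>R c) has_derivative
      (\<lambda>h. (fst h * (f' * g (snd q)) + snd h * (f (fst q) * g')) *\<^sub>R c)) (at q)"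
    if "(f has_real_derivative f') (at (fst q))" "(g has_real_derivative g') (at (snd q))"
    for f g :: "real \<Rightarrow> real" and f' g' and c :: "real^3"
  proof -
    have "((\<lambda>q. f (fst q)) has_derivative (\<lambda>h. f' * fst h)) (at q)"
      using has_derivative_compose[OF has_derivative_fst[OF has_derivative_ident], of f "(*) f'" q UNIV]
        that(1) by (simp add: has_field_derivative_def)
    moreover have "((\<lambda>q. g (snd q)) has_derivative (\<lambda>h. g' * snd h)) (at q)"
      using has_derivative_compose[OF has_derivative_snd[OF has_derivative_ident], of g "(*) g'" q UNIV]
        that(2) by (simp add: has_field_derivative_def)
    ultimately show ?thesis
      by (rule has_derivative_eq_rhs[OF has_derivative_scaleR_left[OF has_derivative_mult]])
        (simp add: fun_eq_iff algebra_simps)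
  qed
  note d = prod[OF DERIV_cos DERIV_cos] prod[OF DERIV_cos DERIV_sin] prod[OF DERIV_sin DERIV_cos]
    prod[OF DERIV_sin DERIV_sin] prod[OF DERIV_cos DERIV_const[of 1], simplified] prod[OF DERIV_sin DERIV_const[of 1], simplified]
  show ?thesis
    unfolding trig_map_def case_prod_unfold
    by (rule has_derivative_eq_rhs[OF has_derivative_add[OF has_derivative_add[OF has_derivative_add[OF
        has_derivative_add[OF has_derivative_add[OF has_derivative_add[OF has_derivative_const[of c0]
          d(1)[of c1]] d(2)[of c2]] d(3)[of c3]] d(4)[of c4]] d(5)[of c5]] d(6)[of c6]]])
      (simp add: fun_eq_iff algebra_simps)
qed

lemma pd_trig_map:
  "pdu (trig_map c0 c1 c2 c3 c4 c5 c6) = trig_map 0 c3 c4 (- c1) (- c2) c6 (- c5)"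
  "pdv (trig_map c0 c1 c2 c3 c4 c5 c6) = trig_map 0 c2 (- c1) c4 (- c3) 0 0"
  unfolding pdu_def pdv_def frechet_derivative_at[OF trig_map_has_derivative, symmetric]
  by (simp_all add: fun_eq_iff)

lemma smooth_on_trig_map: "smooth_on U (trig_map c0 c1 c2 c3 c4 c5 c6)"
proof -
  have "trig_map c0 c1 c2 c3 c4 c5 c6 differentiable_on U" for c0 c1 c2 c3 c4 c5 c6
    unfolding differentiable_on_def
    by (rule ballI, rule differentiable_at_withinI, rule differentiableI, rule trig_map_has_derivative)
  moreover from this have "continuous_on U (trig_map c0 c1 c2 c3 c4 c5 c6)" for c0 c1 c2 c3 c4 c5 c6
    by (rule differentiable_imp_continuous_on)
  ultimately have "ck_on k U (trig_map c0 c1 c2 c3 c4 c5 c6)" for k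
    by (induction k arbitrary: c0 c1 c2 c3 c4 c5 c6) (simp_all add: pd_trig_map)
  then show ?thesis by (simp add: smooth_on_def)
qed

definition geographic :: "real \<times> real \<Rightarrow> real^3" where
  "geographic = (\<lambda>(u, v). vector [cos u * cos v, cos u * sin v, sin u])"

definition geographic_domain :: "(real \<times> real) set" where
  "geographic_domain = {- pi/2<..<pi/2} \<times> {- pi/2<..<pi/2}"

lemma geographic_image:
  "geographic ` geographic_domain = {y \<in> sphere 0 1. 0 < y$1}"
proof (intro equalityI subsetI)
  fix y assume "y \<in> geographic ` geographic_domain"
  then obtain u v where u: "- pi/2 < u" "u < pi/2" and v: "- pi/2 < v" "v < pi/2"
    and y: "y = geographic (u, v)"
    by (auto simp: geographic_domain_def)
  have "0 < cos u" "0 < cos v" using u v by (auto intro!: cos_gt_zero_pi)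
  moreover have "(cos u * cos v)\<^sup>2 + (cos u * sin v)\<^sup>2 + (sin u)\<^sup>2 = (cos u)\<^sup>2 * ((cos v)\<^sup>2 + (sin v)\<^sup>2) + (sin u)\<^sup>2"
    by (simp only: power_mult_distrib distrib_left)
  then have "(cos u * cos v)\<^sup>2 + (cos u * sin v)\<^sup>2 + (sin u)\<^sup>2 = 1"
    by (simp only: sin_cos_squared_add2 mult_1_right)
  ultimately show "y \<in> {y \<in> sphere 0 1. 0 < y$1}"
    unfolding mem_Collect_eq in_sphere_iff y by (simp add: geographic_def)
next
  fix y :: "real^3" assume y: "y \<in> {y \<in> sphere 0 1. 0 < y$1}"
  then have s: "(y$1)\<^sup>2 + (y$2)\<^sup>2 + (y$3)\<^sup>2 = 1" and y1: "0 < y$1"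
    unfolding mem_Collect_eq in_sphere_iff by auto
  define \<rho> where "\<rho> = sqrt (1 - (y$3)\<^sup>2)"
  have pos: "0 < 1 - (y$3)\<^sup>2" using s y1 zero_le_power2[of "y$2"] zero_less_power[OF y1, of 2] by linarith
  then have \<rho>: "0 < \<rho>" "\<rho>\<^sup>2 = 1 - (y$3)\<^sup>2" by (simp_all add: \<rho>_def)
  have b3: "\<bar>y$3\<bar> < 1" using pos unfolding abs_square_less_1[symmetric] by simp
  have q: "(y$2 / \<rho>)\<^sup>2 = 1 - (y$1 / \<rho>)\<^sup>2"
  proof -
    have "(y$2)\<^sup>2 = \<rho>\<^sup>2 - (y$1)\<^sup>2" using s \<rho> by simp
    then show ?thesis using \<rho>(1) by (simp add: power_divide diff_divide_distrib)
  qed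
  have "0 < (y$1 / \<rho>)\<^sup>2" using y1 \<rho> by simp
  then have b2: "\<bar>y$2 / \<rho>\<bar> < 1" using q unfolding abs_square_less_1[symmetric] by linarith
  define u v where "u = arcsin (y$3)" and "v = arcsin (y$2 / \<rho>)"
  have uv: "- pi/2 < u" "u < pi/2" "- pi/2 < v" "v < pi/2"
  proof -
    have c: "- 1 < y$3" "y$3 < 1" "- 1 < y$2 / \<rho>" "y$2 / \<rho> < 1"
      using b2 b3 unfolding abs_less_iff by linarith+
    show "- pi/2 < u" "u < pi/2" "- pi/2 < v" "v < pi/2"
      using arcsin_lt_bounded[OF c(1,2)] arcsin_lt_bounded[OF c(3,4)] unfolding u_def v_def by linarith+
  qed
  have "sin u = y$3" "cos u = \<rho>"
    using b3 by (simp_all add: u_def \<rho>_def cos_arcsin)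
  moreover have "sin v = y$2 / \<rho>" "cos v = y$1 / \<rho>"
  proof -
    show "sin v = y$2 / \<rho>" using b2 unfolding v_def by (intro sin_arcsin) linarith+
    have "cos v = sqrt (1 - (y$2 / \<rho>)\<^sup>2)" using b2 unfolding v_def by (intro cos_arcsin) linarith+
    also have "\<dots> = y$1 / \<rho>" unfolding q using y1 \<rho> by simp
    finally show "cos v = y$1 / \<rho>" .
  qed
  ultimately have "geographic (u, v) = y"
    using \<rho> by (simp add: geographic_def vec_eq_iff forall_3)
  then show "y \<in> geographic ` geographic_domain"
    using uv unfolding geographic_domain_def by force
qed

text \<open>The image of the chart is an open half of the ellipsoid. Precomposing with a rotation moves any given
  point to its centre.\<close>
lemma geographic_local_param:
  assumes g: "linear g" "inj g"
  shows "local_param ((\<lambda>x. o' + g x) ` sphere 0 1) geographic_domain (\<lambda>q. o' + g (geographic q))"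
    (is "local_param ?M ?U ?X")
proof -
  obtain G where G: "linear G" "\<And>x. G (g x) = x"
    using linear_injective_left_inverse[OF g] by (auto simp: fun_eq_iff)
  define e :: "3 \<Rightarrow> real^3" where "e i = g (axis i 1)" for i
  have "geographic (u, v) = (cos u * cos v) *\<^sub>R axis 1 1 + (cos u * sin v) *\<^sub>R axis 2 1 + sin u *\<^sub>R axis 3 1" for u v
    by (simp add: geographic_def vec_eq_iff forall_3 axis_def)
  then have X: "?X = trig_map o' (e 1) (e 2) 0 0 0 (e 3)"
    by (simp add: fun_eq_iff trig_map_def e_def linear_add[OF g(1)] linear_cmul[OF g(1)])
  have ind: "e 1 \<noteq> 0" by (metis G e_def axis_eq_0_iff linear_0[OF G(1)] zero_neq_one)
  have img: "?X ` ?U = {q \<in> ?M. 0 < G (q - o') $ 1}"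
  proof -
    have "?X ` ?U = (\<lambda>y. o' + g y) ` {y \<in> sphere 0 1. 0 < y$1}"
      unfolding geographic_image[symmetric] by (simp add: image_image)
    then show ?thesis by (auto simp: G)
  qed
  have cG: "continuous_on S (\<lambda>q. G (q - o'))" for S
    by (intro bounded_linear.continuous_on[OF G(1)[unfolded linear_conv_bounded_linear]]
        continuous_on_diff continuous_on_id continuous_on_const)
  show ?thesis
    unfolding local_param_def
  proof (intro conjI ballI)
    show "open ?U" by (simp add: geographic_domain_def open_Times)
    show "smooth_on ?U ?X" unfolding X by (rule smooth_on_trig_map)
    show "?X ` ?U \<subseteq> ?M" unfolding img by blast
    have "open {q. 0 < G (q - o') $ 1}" by (rule open_Collect_less[OF continuous_on_const continuous_on_component[OF cG]])
    then show "openin (top_of_set ?M) (?X ` ?U)"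
      unfolding img openin_open by blast
    define Y where "Y q = (let y = G (q - o') in (arcsin (y$3), arctan (y$2 / y$1)))" for q
    have "homeomorphism ?U (?X ` ?U) ?X Y"
      unfolding homeomorphism_def
    proof (intro conjI ballI)
      show "continuous_on ?U ?X"
        unfolding X using smooth_on_trig_map[of ?U] unfolding smooth_on_def
        by (metis ck_on.simps(1))
      show Y: "Y (?X q) = q" if "q \<in> ?U" for q
      proof -
        obtain u v where q: "q = (u, v)" by (cases q)
        have uv: "- pi/2 < u" "u < pi/2" "- pi/2 < v" "v < pi/2"
          using that by (simp_all add: q geographic_domain_def)
        then have "0 < cos u" by (auto intro!: cos_gt_zero_pi)
        then have "cos u * sin v / (cos u * cos v) = tan v" by (simp add: tan_def)
        then show ?thesis
          using uv by (simp add: Y_def G q geographic_def arcsin_sin arctan_tan)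
      qed
      show "continuous_on (?X ` ?U) Y"
        unfolding Y_def Let_def
      proof (intro continuous_intros cG ballI)
        fix q assume "q \<in> ?X ` ?U"
        then have q: "q \<in> ?M" "0 < G (q - o') $ 1" unfolding img by auto
        then show "G (q - o') $ 1 \<noteq> 0" by simp
        obtain y where y: "y \<in> sphere 0 1" "G (q - o') = y" using q by (auto simp: G)
        then have "\<bar>y $ 3\<bar> \<le> 1" using component_le_norm_cart[of y 3] by simp
        then show "- 1 \<le> G (q - o') $ 3 \<and> G (q - o') $ 3 \<le> 1" using y(2) by (simp add: abs_le_iff)
      qed
      show "?X ` ?U = ?X ` ?U" ..
      show "Y ` ?X ` ?U = ?U" using Y by (force simp: image_image)
      show "?X (Y q) = q" if "q \<in> ?X ` ?U" for q using that Y by auto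
    qed
    then show "\<exists>Y. homeomorphism ?U (?X ` ?U) ?X Y" by blast
    fix q assume "q \<in> ?U"
    obtain u v where q: "q = (u, v)" by (cases q)
    have c: "0 < cos u" "0 < cos v" using \<open>q \<in> ?U\<close> by (auto intro!: cos_gt_zero_pi simp: q geographic_domain_def)
    have fd: "frechet_derivative ?X (at q) = (\<lambda>h. fst h *\<^sub>R trig_map 0 0 0 (- e 1) (- e 2) (e 3) 0 q
        + snd h *\<^sub>R trig_map 0 (e 2) (- e 1) 0 0 0 0 q)"
      unfolding X frechet_derivative_at[OF trig_map_has_derivative, symmetric] by simp
    have lin: "linear (frechet_derivative ?X (at q))"
      unfolding fd by (intro linearI) (simp_all add: algebra_simps)
    show "inj (frechet_derivative ?X (at q))"
      unfolding linear_injective_0[OF lin]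
    proof (intro allI impI)
      fix h assume h: "frechet_derivative ?X (at q) h = 0"
      define y :: "real^3" where "y = vector [- fst h * sin u * cos v - snd h * cos u * sin v,
          - fst h * sin u * sin v + snd h * cos u * cos v, fst h * cos u]"
      have ye: "y = (- fst h * sin u * cos v - snd h * cos u * sin v) *\<^sub>R axis 1 1
          + (- fst h * sin u * sin v + snd h * cos u * cos v) *\<^sub>R axis 2 1 + (fst h * cos u) *\<^sub>R axis 3 1"
        by (simp add: y_def vec_eq_iff forall_3 axis_def)
      have "g y = frechet_derivative ?X (at q) h"
        unfolding fd ye by (simp add: e_def trig_map_def q linear_add[OF g(1)] linear_diff[OF g(1)] linear_cmul[OF g(1)] algebra_simps)
      then have "y = 0" using h G(2)[of y] linear_0[OF G(1)] by simp
      then have h0: "fst h * cos u = 0" "- fst h * sin u * cos v - snd h * cos u * sin v = 0"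
          "- fst h * sin u * sin v + snd h * cos u * cos v = 0"
        by (simp_all add: y_def vec_eq_iff forall_3)
      then have "fst h = 0" using c by simp
      moreover from this have "snd h = 0" using h0(3) c by simp
      ultimately show "h = 0" by (simp add: prod_eq_iff)
    qed
  qed
qed

lemma ellipsoid_local_param_exists:
  fixes x :: "real^3"
  assumes L: "linear L" "inj L" and x: "x \<in> sphere 0 1"
  obtains U X q where "local_param ((\<lambda>x. o' + L x) ` sphere 0 1) U X" "q \<in> U" "X q = o' + L x"
proof -
  obtain f where f: "orthogonal_transformation f" "f (axis 1 1 :: real^3) = x"
    using orthogonal_transformation_exists_1[of "axis 1 1 :: real^3" x] x by auto
  have "linear (L \<circ> f)" using L(1) orthogonal_transformation_linear[OF f(1)] by (rule linear_compose[rotated])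
  moreover have "inj (L \<circ> f)" using L(2) orthogonal_transformation_inj[OF f(1)] by (rule inj_compose)
  moreover have "f ` sphere 0 1 = sphere 0 1"
  proof -
    have "f y \<in> sphere 0 1 \<longleftrightarrow> y \<in> sphere 0 1" for y
      by (simp add: orthogonal_transformation_norm[OF f(1)])
    moreover have "\<exists>z. y = f z" for y
      using orthogonal_transformation_surj[OF f(1)] by (simp add: surj_def)
    ultimately show ?thesis by (metis (no_types, lifting) image_eqI image_subsetI subsetI subset_antisym)
  qed
  then have "(\<lambda>x. o' + (L \<circ> f) x) ` sphere 0 1 = (\<lambda>x. o' + L x) ` sphere 0 1"
    by (metis (no_types, lifting) comp_apply image_cong image_image)
  ultimately have "local_param ((\<lambda>x. o' + L x) ` sphere 0 1) geographic_domain (\<lambda>q. o' + (L \<circ> f) (geographic q))"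
    using geographic_local_param[of "L \<circ> f" o'] by metis
  moreover have "(0, 0) \<in> geographic_domain" by (simp add: geographic_domain_def)
  moreover have "geographic (0, 0) = axis 1 1"
    by (simp add: geographic_def vec_eq_iff forall_3 axis_def)
  then have "o' + (L \<circ> f) (geographic (0, 0)) = o' + L x" using f(2) by simp
  ultimately show ?thesis by (rule that)
qed

section \<open>Fundamental forms in an arbitrary local parametrization\<close>

lemma has_frechet_derivative_at:
  assumes "f differentiable_on U" "open U" "q \<in> U"
  shows "(f has_derivative frechet_derivative f (at q)) (at q)"
  using assms differentiable_on_eq_differentiable_at frechet_derivative_works by blast

lemma inner_constant_derivative:
  fixes f g :: "real \<times> real \<Rightarrow> real^3"
  assumes U: "open U" "q \<in> U" and c: "\<And>r. r \<in> U \<Longrightarrow> f r \<bullet> g r = c"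
    and f: "(f has_derivative f') (at q)" and g: "(g has_derivative g') (at q)"
  shows "f q \<bullet> g' h + f' h \<bullet> g q = 0"
proof -
  have "((\<lambda>r. f r \<bullet> g r) has_derivative (\<lambda>h. f q \<bullet> g' h + f' h \<bullet> g q)) (at q)"
    by (rule has_derivative_inner[OF f g])
  moreover have "((\<lambda>r. f r \<bullet> g r) has_derivative (\<lambda>h. 0)) (at q)"
    by (rule has_derivative_transform_within_open[OF has_derivative_const[of c] U]) (simp add: c)
  ultimately show ?thesis using has_derivative_unique by (metis (no_types, lifting))
qed

lemma cross_cross_left: "cross3 (cross3 a b) c = (a \<bullet> c) *\<^sub>R b - (b \<bullet> c) *\<^sub>R a"
  unfolding cross_skew[of "cross3 a b" c] Lagrange by (simp add: inner_commute)

lemma cross_zero_imp_multiple: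
  fixes x y :: "real^3"
  assumes x: "x \<in> sphere 0 1" and y: "cross3 x y = 0"
  shows "y = (y \<bullet> x) *\<^sub>R x"
proof -
  have xx: "x \<bullet> x = 1" using x by (simp add: norm_eq_1)
  have "cross3 (cross3 x y) x = (x \<bullet> x) *\<^sub>R y - (y \<bullet> x) *\<^sub>R x" by (rule cross_cross_left)
  then show ?thesis using xx y by simp
qed

text \<open>The second fundamental form is a determinant of derivatives of the parametrization. An affine map changes it
  by a constant factor only, so that it can be computed on the sphere.\<close>
lemma det_vector_linear_image:
  fixes L :: "real^3 \<Rightarrow> real^3"
  assumes "linear L"
  shows "det (vector [L a, L b, L c] :: real^3^3) = det (matrix L) * (cross3 a b \<bullet> c)"
proof -
  have mult: "L v $ i = (\<Sum>j\<in>UNIV. v $ j * matrix L $ i $ j)" for v i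
    using fun_cong[OF matrix_vector_mul(2)[OF assms], of v] by (simp add: matrix_vector_mult_def vec_eq_iff mult.commute)
  have "(vector [L a, L b, L c] :: real^3^3) = (vector [a, b, c] :: real^3^3) ** transpose (matrix L)"
    by (simp add: vec_eq_iff forall_3 matrix_matrix_mult_def transpose_def mult)
  then have "det (vector [L a, L b, L c] :: real^3^3) = det (vector [a, b, c] :: real^3^3) * det (matrix L)"
    by (simp add: det_mul)
  also have "det (vector [a, b, c] :: real^3^3) = cross3 a b \<bullet> c"
    by (simp add: det_3 cross3_def inner_real3 algebra_simps)
  finally show ?thesis by simp
qed

lemma tangent_combination:
  assumes x: "(x :: real^3) \<in> sphere 0 1" and ab: "cross3 a b = k *\<^sub>R x" "k \<noteq> 0" and w: "w \<bullet> x = 0"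
  obtains du dv where "w = du *\<^sub>R a + dv *\<^sub>R b"
proof -
  have xx: "x \<bullet> x = 1" using x by (simp add: norm_eq_1)
  define c where "c = cross3 w x"
  have 1: "cross3 x c = w"
    using w xx by (simp add: c_def Lagrange inner_commute)
  have "k *\<^sub>R w = cross3 (cross3 a b) c"
    using 1 by (simp add: ab(1) cross_mult_left)
  also have "\<dots> = (a \<bullet> c) *\<^sub>R b - (b \<bullet> c) *\<^sub>R a"
    by (rule cross_cross_left)
  finally have "w = (1 / k) *\<^sub>R ((a \<bullet> c) *\<^sub>R b - (b \<bullet> c) *\<^sub>R a)"
    using ab(2) by (metis divide_self_if scaleR_one scaleR_scaleR times_divide_eq_left mult_1)
  then have "w = (- (b \<bullet> c) / k) *\<^sub>R a + ((a \<bullet> c) / k) *\<^sub>R b"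
    by (simp add: algebra_simps)
  then show ?thesis by (rule that)
qed

lemma normal_parallel:
  assumes x: "(x :: real^3) \<in> sphere 0 1" and ab: "cross3 a b = k *\<^sub>R x" "k \<noteq> 0"
    and v: "v \<bullet> a = 0" "v \<bullet> b = 0"
  shows "v = (v \<bullet> x) *\<^sub>R x"
proof (rule cross_zero_imp_multiple[OF x])
  have "k *\<^sub>R cross3 x v = cross3 (cross3 a b) v" by (simp add: ab(1) cross_mult_left)
  also have "\<dots> = 0" using v by (simp add: cross_cross_left inner_commute)
  finally show "cross3 x v = 0" using ab(2) by simp
qed

text \<open>Cauchy-Binet for the Gram matrices of the Euclidean product and of the normalized form, and the mixed term of
  the two: they express the invariants of the pencil of the two forms through the normal vector.\<close>
lemma gram_identities:
  fixes a b :: "real^3"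
  defines "c \<equiv> cross3 a b"
  shows "(a \<bullet> a) * (b \<bullet> b) - (a \<bullet> b)\<^sup>2 = (c$1)\<^sup>2 + (c$2)\<^sup>2 + (c$3)\<^sup>2"
    and "(form_op p a \<bullet> a) * (form_op p b \<bullet> b) - (form_op p a \<bullet> b)\<^sup>2 = - p * (1 - p) * (c$2)\<^sup>2"
    and "(form_op p a \<bullet> a) * (b \<bullet> b) + (form_op p b \<bullet> b) * (a \<bullet> a) - 2 * (form_op p a \<bullet> b) * (a \<bullet> b)
       = - (1 - p) * (c$1)\<^sup>2 + (2 * p - 1) * (c$2)\<^sup>2 + p * (c$3)\<^sup>2"
  by (simp_all add: c_def cross3_def inner_real3 power2_eq_square algebra_simps)

text \<open>The image of the unit sphere under \<open>x \<mapsto> o' + L x\<close>, where \<open>L\<close> diagonalizes the Minkowski form.\<close>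
locale lorentz_ellipsoid =
  fixes o' :: "real^3" and L :: "real^3 \<Rightarrow> real^3" and A B C :: real
  assumes linear_L: "linear L"
    and form_L: "minner (L x) (L y) = A * (x$1 * y$1) + B * (x$2 * y$2) - C * (x$3 * y$3)"
    and order: "B < A" "0 < B" "0 < C"
begin

definition T :: "real^3 \<Rightarrow> real^3" where "T x = o' + L x"

definition surface :: "(real^3) set" where "surface = T ` sphere 0 1"

definition p :: real where "p = (A - B) / (A + C)"

lemma p: "0 < p" "p < 1"
  using order by (simp_all add: p_def field_simps)

lemma A_C_eq: "A = B + (A + C) * p" "C = (A + C) * (1 - p) - B"
  using order by (simp_all add: p_def field_simps)

text \<open>Adding a multiple of the Euclidean product shifts the eigenvalues and leaves the eigenvectors unchanged. So the
  principal directions depend on \<open>A, B, C\<close> only through \<open>p\<close>.\<close>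
lemma form_L_form_op: "minner (L x) (L y) = B * (x \<bullet> y) + (A + C) * (form_op p x \<bullet> y)"
proof -
  have "B * (x \<bullet> y) + (A + C) * (form_op p x \<bullet> y)
      = (B + (A + C) * p) * (x$1 * y$1) + B * (x$2 * y$2) - ((A + C) * (1 - p) - B) * (x$3 * y$3)"
    by (simp add: inner_real3 algebra_simps)
  then show ?thesis unfolding form_L A_C_eq[symmetric] by simp
qed

lemma inj_L: "inj L"
  unfolding linear_injective_0[OF linear_L]
proof (intro allI impI)
  fix x :: "real^3" assume "L x = 0"
  then have 0: "A * (x$1 * y$1) + B * (x$2 * y$2) - C * (x$3 * y$3) = 0" for y :: "real^3"
    using form_L[of x y] by (simp add: minner_def)
  show "x = 0"
    using 0[of "axis 1 1"] 0[of "axis 2 1"] 0[of "axis 3 1"] order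
    by (simp add: vec_eq_iff forall_3 axis_def)
qed

lemma T_eq_iff [simp]: "T x = T y \<longleftrightarrow> x = y"
  using inj_L by (simp add: T_def inj_eq)

text \<open>In these terms the second fundamental form is a multiple of the Euclidean one. Write \<open>X = o' + L y\<close> with
  \<open>y\<close> on the sphere. Differentiating \<open>\<langle>y, y\<rangle> = 1\<close> twice gives \<open>\<langle>y\<^sub>u, y\<rangle> = 0\<close> and \<open>\<langle>y\<^sub>u\<^sub>u, y\<rangle> = - \<langle>y\<^sub>u, y\<^sub>u\<rangle>\<close>, and
  likewise for the other derivatives. As \<open>y\<^sub>u \<times> y\<^sub>v\<close> is a multiple of \<open>y\<close>, the determinant
  of \<open>y\<^sub>u, y\<^sub>v, y\<^sub>u\<^sub>u\<close> is proportional to \<open>\<langle>y\<^sub>u, y\<^sub>u\<rangle>\<close> with a factor that is the same for all second derivatives.\<close>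
lemma local_param_frame:
  assumes lp: "local_param surface U X" and q: "q \<in> U"
  obtains x a b k \<kappa> where "x \<in> sphere 0 1" "X q = T x" "pdu X q = L a" "pdv X q = L b"
    "cross3 a b = k *\<^sub>R x" "k \<noteq> 0" "a \<bullet> x = 0" "b \<bullet> x = 0"
    "\<kappa> \<noteq> 0" "ebar X q = \<kappa> * (a \<bullet> a)" "fbar X q = \<kappa> * (a \<bullet> b)" "gbar X q = \<kappa> * (b \<bullet> b)"
proof -
  obtain G where G: "linear G" "\<And>x. G (L x) = x" "\<And>x. L (G x) = x"
    using linear_injective_isomorphism[OF linear_L inj_L] by metis
  have bG: "bounded_linear G" using G(1) by (simp add: linear_conv_bounded_linear)
  have U: "open U" and sm: "smooth_on U X" and sub: "X ` U \<subseteq> surface"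
    and inj: "inj (frechet_derivative X (at q))"
    using lp q by (auto simp: local_param_def)
  have "ck_on (Suc (Suc 0)) U X" using sm unfolding smooth_on_def by blast
  then have diff: "X differentiable_on U" "pdu X differentiable_on U" "pdv X differentiable_on U"
    by simp_all
  define y where "y r = G (X r - o')" for r
  have yX: "y r \<in> sphere 0 1 \<and> X r = T (y r)" if "r \<in> U" for r
    using sub that by (auto simp: surface_def y_def T_def image_subset_iff G)
  have dy: "(y has_derivative (\<lambda>h. G (frechet_derivative X (at r) h))) (at r)" if "r \<in> U" for r
    using bounded_linear.has_derivative[OF bG has_derivative_diff[OF has_frechet_derivative_at[OF diff(1) U that] has_derivative_const[of o']]]
    unfolding y_def by simp
  define a where "a r = G (pdu X r)" for r
  define b where "b r = G (pdv X r)" for r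
  have da: "(a has_derivative (\<lambda>h. G (frechet_derivative (pdu X) (at q) h))) (at q)"
    unfolding a_def by (rule bounded_linear.has_derivative[OF bG has_frechet_derivative_at[OF diff(2) U q]])
  have db: "(b has_derivative (\<lambda>h. G (frechet_derivative (pdv X) (at q) h))) (at q)"
    unfolding b_def by (rule bounded_linear.has_derivative[OF bG has_frechet_derivative_at[OF diff(3) U q]])
  have "y r \<bullet> G (frechet_derivative X (at r) h) = 0" if "r \<in> U" for r h
  proof -
    have "y r \<bullet> y r = 1" if "r \<in> U" for r using yX[OF that] by (simp add: norm_eq_1)
    from inner_constant_derivative[OF U that this dy[OF that] dy[OF that], of h] show ?thesis
      by (simp add: inner_commute)
  qed
  then have ya: "y r \<bullet> a r = 0" "y r \<bullet> b r = 0" if "r \<in> U" for r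
    using that by (simp_all add: a_def b_def pdu_def pdv_def)
  define x where "x = y q"
  have x: "x \<in> sphere 0 1" "X q = T x" using yX[OF q] by (simp_all add: x_def)
  have xx: "x \<bullet> x = 1" using x by (simp add: norm_eq_1)
  have second: "G (frechet_derivative (pdu X) (at q) h) \<bullet> x = - (a q \<bullet> G (frechet_derivative X (at q) h))"
      "G (frechet_derivative (pdv X) (at q) h) \<bullet> x = - (b q \<bullet> G (frechet_derivative X (at q) h))" for h
    using inner_constant_derivative[OF U q ya(1) dy[OF q] da, of h]
      inner_constant_derivative[OF U q ya(2) dy[OF q] db, of h]
    by (simp_all add: x_def inner_commute)
  have acc: "G (pdu (pdu X) q) \<bullet> x = - (a q \<bullet> a q)" "G (pdv (pdu X) q) \<bullet> x = - (a q \<bullet> b q)"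
      "G (pdv (pdv X) q) \<bullet> x = - (b q \<bullet> b q)"
    using second(1)[of "(1, 0)"] second(1)[of "(0, 1)"] second(2)[of "(0, 1)"]
    by (simp_all add: a_def b_def pdu_def pdv_def)
  have ax: "a q \<bullet> x = 0" "b q \<bullet> x = 0" using ya[OF q] by (simp_all add: x_def inner_commute)
  define k where "k = cross3 (a q) (b q) \<bullet> x"
  have ab: "cross3 (a q) (b q) = k *\<^sub>R x"
    unfolding k_def
  proof (rule cross_zero_imp_multiple[OF x(1)])
    have "cross3 x (cross3 (a q) (b q)) = - cross3 (cross3 (a q) (b q)) x" by (rule cross_skew)
    also have "\<dots> = 0" using ax by (simp add: cross_cross_left)
    finally show "cross3 x (cross3 (a q) (b q)) = 0" .
  qed
  have lfd: "linear (frechet_derivative X (at q))"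
    using has_frechet_derivative_at[OF diff(1) U q] has_derivative_linear by blast
  have fd: "frechet_derivative X (at q) (s, t) = s *\<^sub>R L (a q) + t *\<^sub>R L (b q)" for s t
  proof -
    have "(s, t) = s *\<^sub>R (1, 0) + t *\<^sub>R (0, 1)" by simp
    then show ?thesis
      by (simp only: linear_add[OF lfd] linear_cmul[OF lfd] a_def b_def G pdu_def pdv_def)
  qed
  have fd0: "s = 0 \<and> t = 0" if "s *\<^sub>R a q + t *\<^sub>R b q = 0" for s t
  proof -
    have "frechet_derivative X (at q) (s, t) = L (s *\<^sub>R a q + t *\<^sub>R b q)"
      by (simp add: fd linear_add[OF linear_L] linear_cmul[OF linear_L])
    then have "frechet_derivative X (at q) (s, t) = 0" using that linear_0[OF linear_L] by simp
    then have "(s, t) = 0" using inj linear_injective_0[OF lfd] by blast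
    then show ?thesis by (simp add: zero_prod_def)
  qed
  have k0: "k \<noteq> 0"
  proof
    assume "k = 0"
    then have "cross3 (cross3 (a q) (b q)) (a q) = 0" using ab by simp
    then have "(- (b q \<bullet> a q)) *\<^sub>R a q + (a q \<bullet> a q) *\<^sub>R b q = 0" by (simp add: cross_cross_left)
    then have "a q = 0" using fd0 by fastforce
    then show False using fd0[of 1 0] by simp
  qed
  define \<kappa> where "\<kappa> = - det (matrix L) * k"
  have "\<kappa> \<noteq> 0"
    using k0 det_nz_iff_inj[OF linear_L] inj_L by (simp add: \<kappa>_def)
  moreover have "minner w (mcross (pdu X q) (pdv X q)) = - \<kappa> * (G w \<bullet> x)" for w
  proof -
    have "minner w (mcross (pdu X q) (pdv X q)) = minner (mcross (L (a q)) (L (b q))) (L (G w))"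
      by (simp add: a_def b_def G minner_def algebra_simps)
    also have "\<dots> = det (matrix L) * (cross3 (a q) (b q) \<bullet> G w)"
      unfolding minner_mcross by (rule det_vector_linear_image[OF linear_L])
    finally show ?thesis by (simp add: ab \<kappa>_def inner_commute)
  qed
  then have "ebar X q = \<kappa> * (a q \<bullet> a q)" "fbar X q = \<kappa> * (a q \<bullet> b q)" "gbar X q = \<kappa> * (b q \<bullet> b q)"
    by (simp_all add: ebar_def fbar_def gbar_def acc)
  moreover have "pdu X q = L (a q)" "pdv X q = L (b q)" by (simp_all add: a_def b_def G)
  ultimately show ?thesis using that[OF x(1,2) _ _ ab k0 ax] by blast
qed

text \<open>With the second form equal to \<open>\<kappa>\<close> times the Euclidean product, the coefficients \<open>L\<^sub>1, M\<^sub>1, N\<^sub>1\<close> only see the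
  normalized form. The discriminant of the equation is, up to a positive factor, that of the
  characteristic polynomial. The equation of principal lines says that, restricted to the tangent plane, the functionals \<open>\<langle>Q w, _\<rangle>\<close> and
  \<open>\<langle>w, _\<rangle>\<close> are proportional, so that \<open>w\<close> is an eigenvector. The determinant of the first
  form is, up to a positive factor, the product of the eigenvalues \<open>B + (A + C) p u\<close> and
  \<open>B - (B + C) v\<close>, of which the first one is positive.\<close>
lemma local_param_invariants:
  assumes lp: "local_param surface U X" and q: "q \<in> U" and Xq: "X q = T x"
  shows local_param_discriminant:
      "\<exists>c>0. (M1 X q)\<^sup>2 - 4 * L1 X q * N1 X q = c * (eigenvalue_gap p x)\<^sup>2"
    and local_param_umbilic: "L1 X q = 0 \<and> M1 X q = 0 \<and> N1 X q = 0 \<longleftrightarrow> eigenvalue_gap p x = 0"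
    and local_param_tropic:
      "Ecoef X q * Gcoef X q - (Fcoef X q)\<^sup>2 = 0 \<longleftrightarrow> conic_v p x = B / (B + C)"
    and local_param_principal:
      "{span {du *\<^sub>R pdu X q + dv *\<^sub>R pdv X q} | du dv. (du, dv) \<noteq> (0, 0) \<and>
          L1 X q * dv\<^sup>2 + M1 X q * du * dv + N1 X q * du\<^sup>2 = 0}
       = {L ` span {w} | w. w \<noteq> 0 \<and> (\<exists>\<nu>. w \<in> eigenspace p x \<nu>)}"
proof -
  obtain x' a b k \<kappa> where fr': "x' \<in> sphere 0 1" "X q = T x'" "pdu X q = L a" "pdv X q = L b"
    "cross3 a b = k *\<^sub>R x'" "k \<noteq> 0" "a \<bullet> x' = 0" "b \<bullet> x' = 0"
    "\<kappa> \<noteq> 0" "ebar X q = \<kappa> * (a \<bullet> a)" "fbar X q = \<kappa> * (a \<bullet> b)" "gbar X q = \<kappa> * (b \<bullet> b)"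
    by (rule local_param_frame[OF lp q])
  have "x' = x" using fr'(2) Xq by simp
  note fr = fr'[unfolded this]
  define S where "S = A + C"
  have S: "0 < S" using order by (simp add: S_def)
  have c: "cross3 a b $ i = k * x $ i" for i by (simp add: fr(5))
  have sx: "(x$1)\<^sup>2 + (x$2)\<^sup>2 + (x$3)\<^sup>2 = 1" using fr(1) by (simp only: in_sphere_iff)
  have tba: "form_op p b \<bullet> a = form_op p a \<bullet> b" by (metis form_op_selfadjoint inner_commute)
  define aa ab bb ta tab tb where "aa = a \<bullet> a" and "ab = a \<bullet> b" and "bb = b \<bullet> b"
    and "ta = form_op p a \<bullet> a" and "tab = form_op p a \<bullet> b" and "tb = form_op p b \<bullet> b"
  have EFG: "Ecoef X q = B * aa + S * ta" "Fcoef X q = B * ab + S * tab" "Gcoef X q = B * bb + S * tb"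
    by (simp_all add: Ecoef_def Fcoef_def Gcoef_def fr form_L_form_op S_def aa_def ab_def bb_def ta_def tab_def tb_def)
  have efg: "ebar X q = \<kappa> * aa" "fbar X q = \<kappa> * ab" "gbar X q = \<kappa> * bb"
    by (simp_all add: fr aa_def ab_def bb_def)
  have LMN: "L1 X q = \<kappa> * S * (tab * bb - tb * ab)" "M1 X q = \<kappa> * S * (ta * bb - tb * aa)"
      "N1 X q = \<kappa> * S * (ta * ab - tab * aa)"
    unfolding L1_def M1_def N1_def EFG efg by (simp_all add: algebra_simps)
  have gram: "aa * bb - ab\<^sup>2 = k\<^sup>2"
    "ta * tb - tab\<^sup>2 = k\<^sup>2 * (- p * (1 - p) * (x$2)\<^sup>2)"
    "ta * bb + tb * aa - 2 * tab * ab = k\<^sup>2 * eigenvalue_sum p x"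
  proof -
    have "aa * bb - ab\<^sup>2 = k\<^sup>2 * ((x$1)\<^sup>2 + (x$2)\<^sup>2 + (x$3)\<^sup>2)"
      unfolding aa_def bb_def ab_def gram_identities c by (simp add: power_mult_distrib algebra_simps)
    then show "aa * bb - ab\<^sup>2 = k\<^sup>2" unfolding sx by simp
    show "ta * tb - tab\<^sup>2 = k\<^sup>2 * (- p * (1 - p) * (x$2)\<^sup>2)"
      unfolding ta_def tb_def tab_def gram_identities c by (simp add: power_mult_distrib algebra_simps)
    have eigenvalue_sum: "eigenvalue_sum p x = - (1 - p) * (x$1)\<^sup>2 + (2 * p - 1) * (x$2)\<^sup>2 + p * (x$3)\<^sup>2"
      using sx unfolding eigenvalue_sum_def by algebra
    show "ta * bb + tb * aa - 2 * tab * ab = k\<^sup>2 * eigenvalue_sum p x"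
      unfolding ta_def tb_def tab_def aa_def bb_def ab_def gram_identities c eigenvalue_sum
      by (simp add: power_mult_distrib algebra_simps)
  qed
  have disc: "(M1 X q)\<^sup>2 - 4 * L1 X q * N1 X q = (\<kappa> * S * k\<^sup>2)\<^sup>2 * (eigenvalue_gap p x)\<^sup>2"
  proof -
    have "(M1 X q)\<^sup>2 - 4 * L1 X q * N1 X q = (\<kappa> * S)\<^sup>2 *
      ((ta * bb + tb * aa - 2 * tab * ab)\<^sup>2 - 4 * (ta * tb - tab\<^sup>2) * (aa * bb - ab\<^sup>2))"
      unfolding LMN by (simp add: power2_eq_square algebra_simps)
    also have "\<dots> = (\<kappa> * S * k\<^sup>2)\<^sup>2 * ((eigenvalue_sum p x)\<^sup>2 + 4 * p * (1 - p) * (x$2)\<^sup>2)"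
      unfolding gram by (simp add: power2_eq_square algebra_simps)
    finally show ?thesis by (simp only: eigenvalue_gap_square[OF p])
  qed
  have cpos: "0 < (\<kappa> * S * k\<^sup>2)\<^sup>2" using fr S by simp
  then show "\<exists>c>0. (M1 X q)\<^sup>2 - 4 * L1 X q * N1 X q = c * (eigenvalue_gap p x)\<^sup>2"
    using disc by blast
  have a0: "a \<noteq> 0" using fr(5,6) sx by force
  have aapos: "0 < aa" using a0 by (simp add: aa_def)
  show "L1 X q = 0 \<and> M1 X q = 0 \<and> N1 X q = 0 \<longleftrightarrow> eigenvalue_gap p x = 0"
  proof
    assume "L1 X q = 0 \<and> M1 X q = 0 \<and> N1 X q = 0"
    then have "(\<kappa> * S * k\<^sup>2)\<^sup>2 * (eigenvalue_gap p x)\<^sup>2 = 0" using disc by simp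
    then show "eigenvalue_gap p x = 0" using cpos by (metis mult_eq_0_iff less_irrefl power2_eq_square)
  next
    assume "eigenvalue_gap p x = 0"
    then have d0: "(M1 X q)\<^sup>2 - 4 * L1 X q * N1 X q = 0" using disc by simp
      \<comment> \<open>Completing the square: \<open>aa\<^sup>2\<close> times the discriminant is a sum of two squares.\<close>
  have rel: "aa * L1 X q = ab * M1 X q - bb * N1 X q"
      unfolding LMN by (simp add: algebra_simps)
    have "aa\<^sup>2 * ((M1 X q)\<^sup>2 - 4 * L1 X q * N1 X q)
      = aa\<^sup>2 * (M1 X q)\<^sup>2 - 4 * aa * (aa * L1 X q) * N1 X q"
      by (simp add: power2_eq_square algebra_simps)
    also have "\<dots> = (aa * M1 X q - 2 * ab * N1 X q)\<^sup>2 + (2 * N1 X q)\<^sup>2 * (aa * bb - ab\<^sup>2)"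
      unfolding rel by (simp add: power2_eq_square algebra_simps)
    also have "\<dots> = (aa * M1 X q - 2 * ab * N1 X q)\<^sup>2 + (2 * N1 X q * k)\<^sup>2"
      unfolding gram by (simp add: power_mult_distrib)
    finally have "(aa * M1 X q - 2 * ab * N1 X q)\<^sup>2 + (2 * N1 X q * k)\<^sup>2 = 0"
      using d0 by simp
    then have "aa * M1 X q - 2 * ab * N1 X q = 0" "2 * N1 X q * k = 0"
      by (simp_all only: sum_power2_eq_zero_iff)
    then have "N1 X q = 0" "M1 X q = 0" using aapos fr(6) by auto
    moreover from this have "L1 X q = 0" using rel aapos by simp
    ultimately show "L1 X q = 0 \<and> M1 X q = 0 \<and> N1 X q = 0" by blast
  qed
  show "Ecoef X q * Gcoef X q - (Fcoef X q)\<^sup>2 = 0 \<longleftrightarrow> conic_v p x = B / (B + C)"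
  proof -
    define u v where "u = conic_u p x" and "v = conic_v p x"
    have BC: "B + C = S * (1 - p)" using A_C_eq(2) by (simp add: S_def)
    have "Ecoef X q * Gcoef X q - (Fcoef X q)\<^sup>2
      = B\<^sup>2 * (aa * bb - ab\<^sup>2) + B * S * (ta * bb + tb * aa - 2 * tab * ab) + S\<^sup>2 * (ta * tb - tab\<^sup>2)"
      unfolding EFG by (simp add: power2_eq_square algebra_simps)
    also have "\<dots> = k\<^sup>2 * (B\<^sup>2 + B * S * eigenvalue_sum p x - S\<^sup>2 * p * (1 - p) * (x$2)\<^sup>2)"
      unfolding gram by (simp add: algebra_simps)
    also have "\<dots> = k\<^sup>2 * ((B + S * p * u) * (B - (B + C) * v))"
      unfolding conic_eqs[OF p] sq2_conic[OF p] u_def[symmetric] v_def[symmetric] BC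
      by (simp add: power2_eq_square algebra_simps)
    finally have "Ecoef X q * Gcoef X q - (Fcoef X q)\<^sup>2 = k\<^sup>2 * ((B + S * p * u) * (B - (B + C) * v))" .
    moreover have "0 < B + S * p * u"
      using order S p conic_nonneg(1)[OF p, of x] by (simp add: u_def add_pos_nonneg)
    ultimately have "Ecoef X q * Gcoef X q - (Fcoef X q)\<^sup>2 = 0 \<longleftrightarrow> B - (B + C) * v = 0"
      using fr(6) by (simp only: mult_eq_0_iff power_eq_0_iff) simp
    also have "\<dots> \<longleftrightarrow> v = B / (B + C)"
      using order by (auto simp: field_simps)
    finally show ?thesis by (simp add: v_def)
  qed
  have bracket: "L1 X q * dv\<^sup>2 + M1 X q * du * dv + N1 X q * du\<^sup>2
      = \<kappa> * S * ((form_op p w \<bullet> a) * (w \<bullet> b) - (form_op p w \<bullet> b) * (w \<bullet> a))"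
    if "w = du *\<^sub>R a + dv *\<^sub>R b" for w du dv
  proof -
    have "w \<bullet> a = du * aa + dv * ab" "w \<bullet> b = du * ab + dv * bb"
      "form_op p w \<bullet> a = du * ta + dv * tab" "form_op p w \<bullet> b = du * tab + dv * tb"
      by (simp_all add: that inner_simps linear_add[OF linear_form_op] linear_cmul[OF linear_form_op]
          aa_def ab_def bb_def ta_def tab_def tb_def tba inner_commute[of b a])
    then show ?thesis unfolding LMN by (simp add: power2_eq_square algebra_simps)
  qed
  have indep: "du = 0 \<and> dv = 0" if "du *\<^sub>R a + dv *\<^sub>R b = 0" for du dv
  proof -
    have "cross3 (du *\<^sub>R a + dv *\<^sub>R b) b = (du * k) *\<^sub>R x" "cross3 a (du *\<^sub>R a + dv *\<^sub>R b) = (dv * k) *\<^sub>R x"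
      by (simp_all add: cross_add_left cross_add_right cross_mult_left cross_mult_right fr(5))
    then have "(du * k) *\<^sub>R x = 0" "(dv * k) *\<^sub>R x = 0" using that by simp_all
    moreover have "x \<noteq> 0" using fr(1) by auto
    ultimately show ?thesis using fr(6) by simp
  qed
  have principal: "(form_op p w \<bullet> a) * (w \<bullet> b) - (form_op p w \<bullet> b) * (w \<bullet> a) = 0 \<longleftrightarrow> (\<exists>\<nu>. w \<in> eigenspace p x \<nu>)"
    if w: "w = du *\<^sub>R a + dv *\<^sub>R b" "w \<noteq> 0" for w du dv
  proof
    assume br: "(form_op p w \<bullet> a) * (w \<bullet> b) - (form_op p w \<bullet> b) * (w \<bullet> a) = 0"
    \<comment> \<open>The Rayleigh quotient is the only candidate for the eigenvalue.\<close>
    define \<nu> where "\<nu> = (form_op p w \<bullet> w) / (w \<bullet> w)"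
    have ww: "w \<bullet> w \<noteq> 0" using w(2) by simp
    have e: "form_op p w \<bullet> w = du * (form_op p w \<bullet> a) + dv * (form_op p w \<bullet> b)" "w \<bullet> w = du * (w \<bullet> a) + dv * (w \<bullet> b)"
      using w(1) by (metis inner_add_right inner_scaleR_right)+
    have "(form_op p w \<bullet> w) * (w \<bullet> a) = (form_op p w \<bullet> a) * (w \<bullet> w)"
      "(form_op p w \<bullet> w) * (w \<bullet> b) = (form_op p w \<bullet> b) * (w \<bullet> w)"
      unfolding e using br by algebra+
    then have n: "(form_op p w - \<nu> *\<^sub>R w) \<bullet> a = 0" "(form_op p w - \<nu> *\<^sub>R w) \<bullet> b = 0"
      using ww by (simp_all add: \<nu>_def inner_simps divide_simps)
    have "form_op p w = \<nu> *\<^sub>R w + ((form_op p w - \<nu> *\<^sub>R w) \<bullet> x) *\<^sub>R x"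
      using normal_parallel[OF fr(1,5,6) n] by (metis add_diff_cancel_left' diff_add_cancel add.commute)
    moreover have "w \<bullet> x = 0" using w(1) fr(7,8) by (simp add: inner_simps)
    ultimately have "w \<in> eigenspace p x \<nu>" unfolding eigenspace_def by blast
    then show "\<exists>\<nu>. w \<in> eigenspace p x \<nu>" ..
  next
    assume "\<exists>\<nu>. w \<in> eigenspace p x \<nu>"
    then obtain \<nu> t where "form_op p w = \<nu> *\<^sub>R w + t *\<^sub>R x" by (auto simp: eigenspace_def)
    then show "(form_op p w \<bullet> a) * (w \<bullet> b) - (form_op p w \<bullet> b) * (w \<bullet> a) = 0"
      using fr(7,8) by (simp add: inner_simps inner_commute[of x])
  qed
  have \<kappa>S: "\<kappa> * S \<noteq> 0" using fr(9) S by simp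
  have spanL: "span {du *\<^sub>R pdu X q + dv *\<^sub>R pdv X q} = L ` span {du *\<^sub>R a + dv *\<^sub>R b}" for du dv
    using linear_span_image[OF linear_L, of "{du *\<^sub>R a + dv *\<^sub>R b}"]
    by (simp add: fr linear_add[OF linear_L] linear_cmul[OF linear_L])
  show "{span {du *\<^sub>R pdu X q + dv *\<^sub>R pdv X q} | du dv. (du, dv) \<noteq> (0, 0) \<and>
          L1 X q * dv\<^sup>2 + M1 X q * du * dv + N1 X q * du\<^sup>2 = 0}
       = {L ` span {w} | w. w \<noteq> 0 \<and> (\<exists>\<nu>. w \<in> eigenspace p x \<nu>)}" (is "?l = ?r")
  proof (intro equalityI subsetI)
    fix l assume "l \<in> ?l"
    then obtain du dv where l: "l = L ` span {du *\<^sub>R a + dv *\<^sub>R b}" and ne: "(du, dv) \<noteq> (0, 0)"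
      and eq: "L1 X q * dv\<^sup>2 + M1 X q * du * dv + N1 X q * du\<^sup>2 = 0"
      unfolding spanL by blast
    have w: "du *\<^sub>R a + dv *\<^sub>R b \<noteq> 0" using ne indep by blast
    then have "\<exists>\<nu>. du *\<^sub>R a + dv *\<^sub>R b \<in> eigenspace p x \<nu>"
      using eq bracket[OF refl, of dv du] principal[OF refl w] \<kappa>S by (metis mult_eq_0_iff)
    then show "l \<in> ?r" using l w by blast
  next
    fix l assume "l \<in> ?r"
    then obtain w \<nu> where l: "l = L ` span {w}" "w \<noteq> 0" and e: "w \<in> eigenspace p x \<nu>" by blast
    then have "w \<bullet> x = 0" by (simp add: eigenspace_def)
    then obtain du dv where w: "w = du *\<^sub>R a + dv *\<^sub>R b"
      by (rule tangent_combination[OF fr(1,5,6)])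
    have "(du, dv) \<noteq> (0, 0)" using w l(2) by auto
    moreover have "L1 X q * dv\<^sup>2 + M1 X q * du * dv + N1 X q * du\<^sup>2 = 0"
      using bracket[OF w] principal[OF w l(2)] e by (metis mult_zero_right)
    ultimately show "l \<in> ?l" using l w spanL by blast
  qed
qed

end

section \<open>The principal configuration of an ellipsoid\<close>

lemma continuous_first_line:
  assumes p: "0 < p" "p < 1" and L: "linear L" "inj L"
    and R: "R = (\<lambda>x. o' + L x) ` nonumbilic p"
    and D: "\<And>x. x \<in> nonumbilic p \<Longrightarrow> D (o' + L x) = L ` first_line p x"
  shows "continuous_line_field R D"
  unfolding continuous_line_field_def
proof (intro ballI)
  obtain G where G: "linear G" "\<And>x. G (L x) = x"
    using linear_injective_left_inverse[OF L] by (auto simp: fun_eq_iff)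
  have bG: "bounded_linear G" and bL: "bounded_linear L"
    using G(1) L(1) by (simp_all add: linear_conv_bounded_linear)
  fix q assume "q \<in> R"
  then obtain x0 where x0: "x0 \<in> nonumbilic p" "q = o' + L x0" by (auto simp: R)
  note x0' = nonumbilicD[OF x0(1)]
  obtain d where d: "d \<noteq> 0" "d \<in> eigenspace p x0 (p * conic_u p x0)"
    using eigenvalue_iff[OF p x0'(1)] by blast
  define V where "V q = L (eigenfield p d (G (q - o')))" for q
  have VL: "V (o' + L x) = L (eigenfield p d x)" for x by (simp add: V_def G)
  have L0: "L w = 0 \<longleftrightarrow> w = 0" for w using L(2) linear_0[OF L(1)] by (metis injD)
  have cV: "continuous_on R V"
  proof -
    have "continuous_on R (\<lambda>q. G (q - o'))"
      by (intro bounded_linear.continuous_on[OF bG] continuous_on_diff continuous_on_id continuous_on_const)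
    from continuous_on_compose2[OF continuous_on_eigenfield[of UNIV p d] this]
    show ?thesis unfolding V_def by (intro bounded_linear.continuous_on[OF bL]) simp
  qed
  define W where "W = {q \<in> R. V q \<noteq> 0}"
  have "W = R \<inter> V -` (- {0})" by (auto simp: W_def)
  then have "openin (top_of_set R) W"
    using continuous_openin_preimage_gen[OF cV, of "- {0}"] by (simp add: open_Compl)
  moreover have "V q \<noteq> 0"
    unfolding x0(2) VL eigenfield_in_eigenspace(2)[OF p x0' d(2)] L0 using d(1) x0'(2) by simp
  then have "q \<in> W" using \<open>q \<in> R\<close> by (simp add: W_def)
  moreover have "continuous_on W V" using cV by (rule continuous_on_subset) (simp add: W_def)
  moreover have "V r \<noteq> 0 \<and> D r = span {V r}" if rW: "r \<in> W" for r
  proof -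
    obtain x where x: "x \<in> nonumbilic p" "r = o' + L x" using rW unfolding W_def R by blast
    note x' = nonumbilicD[OF x(1)]
    have "V r \<noteq> 0" using rW by (simp add: W_def)
    moreover from this have "eigenfield p d x \<noteq> 0" unfolding x(2) VL L0 .
    then have "D r = L ` span {eigenfield p d x}"
      unfolding x(2) D[OF x(1)] first_line_def
      using eigenspace_eq_span[OF p x' eigenfield_in_eigenspace(1)[OF p x']] by simp
    then have "D r = span {V r}"
      using linear_span_image[OF L(1), of "{eigenfield p d x}"] by (simp add: x(2) VL)
    ultimately show ?thesis by blast
  qed
  ultimately show "\<exists>W V. openin (top_of_set R) W \<and> q \<in> W \<and> continuous_on W V \<and>
      (\<forall>r\<in>W. V r \<noteq> (0 :: real^3) \<and> D r = span {V r})" by blast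
qed

definition second_line :: "real \<Rightarrow> real^3 \<Rightarrow> (real^3) set" where
  "second_line p x = flip ` first_line (1 - p) (flip x)"

definition second_leaf_label :: "real \<Rightarrow> real^3 \<Rightarrow> real \<times> real" where
  "second_leaf_label p x = leaf_label (1 - p) (flip x)"

lemma second_line_eq: "second_line p x = eigenspace p x (- (1 - p) * conic_v p x)"
  unfolding second_line_def first_line_def flip_eigenspace conic_u_flip mult_minus_left ..

lemma second_leaf_label_eq: "second_leaf_label p x = (conic_u p x, sgn (x$1))"
  using conic_u_flip[of "1 - p" "flip x"] by (simp add: second_leaf_label_def leaf_label_def)

lemma flip_nonumbilic: "flip x \<in> nonumbilic (1 - p) \<longleftrightarrow> x \<in> nonumbilic p"
  unfolding nonumbilic_def mem_Collect_eq flip_in_sphere eigenvalue_gap_flip ..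

lemma flip_image_nonumbilic: "flip ` nonumbilic (1 - p) = nonumbilic p"
proof -
  have "x \<in> flip ` nonumbilic (1 - p) \<longleftrightarrow> flip x \<in> nonumbilic (1 - p)" for x
    by (metis flip_flip image_iff)
  then show ?thesis by (auto simp: flip_nonumbilic)
qed

lemma inj_flip: "inj flip"
  by (metis flip_flip injI)

text \<open>The second eigenline is the image under the exchange of axes of the first one for \<open>1 - p\<close>.\<close>
lemma eigenlines:
  assumes p: "0 < p" "p < 1" and x: "x \<in> nonumbilic p"
  shows "{span {w} | w. w \<noteq> 0 \<and> (\<exists>\<nu>. w \<in> eigenspace p x \<nu>)} = {first_line p x, second_line p x}"
    and "first_line p x \<noteq> second_line p x"
proof -
  note x' = nonumbilicD[OF x]
  have 1: "first_line p x = span {w}" if "w \<in> first_line p x" "w \<noteq> 0" for w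
    using eigenspace_eq_span[OF p x'] that by (simp add: first_line_def)
  have 2: "second_line p x = span {w}" if w: "w \<in> second_line p x" "w \<noteq> 0" for w
  proof -
    have fx: "flip x \<in> sphere 0 1" "eigenvalue_gap (1 - p) (flip x) \<noteq> 0"
      using x' unfolding flip_in_sphere eigenvalue_gap_flip by simp_all
    have "flip w \<in> first_line (1 - p) (flip x)"
      using w(1) unfolding second_line_def by auto
    moreover have "flip w \<noteq> 0" using w(2) by (metis flip_flip linear_0 linear_flip)
    ultimately have "first_line (1 - p) (flip x) = span {flip w}"
      using eigenspace_eq_span[of "1 - p", OF _ _ fx] p by (simp add: first_line_def)
    then show ?thesis
      using linear_span_image[OF linear_flip, of "{flip w}"] by (simp add: second_line_def)
  qed
  obtain w where w: "w \<noteq> 0" "w \<in> first_line p x"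
    using eigenvalue_iff[OF p x'(1)] unfolding first_line_def by blast
  obtain z where z: "z \<noteq> 0" "z \<in> second_line p x"
    using eigenvalue_iff[OF p x'(1)] unfolding second_line_eq by blast
  show "{span {w} | w. w \<noteq> 0 \<and> (\<exists>\<nu>. w \<in> eigenspace p x \<nu>)} = {first_line p x, second_line p x}"
  proof (intro equalityI subsetI)
    fix l assume "l \<in> {span {w} | w. w \<noteq> 0 \<and> (\<exists>\<nu>. w \<in> eigenspace p x \<nu>)}"
    then obtain v \<nu> where v: "l = span {v}" "v \<noteq> 0" "v \<in> eigenspace p x \<nu>" by blast
    then have "v \<in> first_line p x \<or> v \<in> second_line p x"
      using eigenvalue_iff[OF p x'(1), of \<nu>] unfolding first_line_def second_line_eq by blast
    then show "l \<in> {first_line p x, second_line p x}" using 1 2 v by auto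
  next
    fix l assume "l \<in> {first_line p x, second_line p x}"
    then consider "l = span {w}" | "l = span {z}" using 1[OF w(2,1)] 2[OF z(2,1)] by auto
    then show "l \<in> {span {w} | w. w \<noteq> 0 \<and> (\<exists>\<nu>. w \<in> eigenspace p x \<nu>)}"
      using w z unfolding first_line_def second_line_eq by cases blast+
  qed
  show "first_line p x \<noteq> second_line p x"
  proof
    assume "first_line p x = second_line p x"
    then have "w \<bullet> w = 0"
      using eigenspaces_orthogonal[OF _ _ eigenvalues_distinct[OF p x'(2)]] w(2)
      unfolding first_line_def second_line_eq by metis
    then show False using w(1) by simp
  qed
qed

context lorentz_ellipsoid
begin

lemma inj_T: "inj T"
  by (simp add: inj_def)

lemma surface_eq: "surface = (\<lambda>x. o' + L x) ` sphere 0 1"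
  by (simp add: surface_def T_def)

lemma local_param_exists:
  assumes "x \<in> sphere 0 1"
  obtains U X q where "local_param surface U X" "q \<in> U" "X q = T x"
  by (rule ellipsoid_local_param_exists[OF linear_L inj_L assms, of o']) (rule that[unfolded surface_eq T_def])

lemma local_param_point:
  assumes "local_param surface U X" "q \<in> U"
  obtains x where "x \<in> sphere 0 1" "X q = T x"
proof -
  have "X q \<in> T ` sphere 0 1"
    using assms unfolding local_param_def surface_def by blast
  then show ?thesis using that by blast
qed

text \<open>A condition that is independent of the local parametrization describes the same set of points whichever
  parametrizations are used, and there is one around every point.\<close>
lemma point_set_eq:
  assumes "\<And>U X q x. local_param surface U X \<Longrightarrow> q \<in> U \<Longrightarrow> X q = T x \<Longrightarrow> P X q \<longleftrightarrow> Q x"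
  shows "{X q | U X q. local_param surface U X \<and> q \<in> U \<and> P X q} = T ` {x \<in> sphere 0 1. Q x}"
proof (intro equalityI subsetI)
  fix r assume "r \<in> {X q | U X q. local_param surface U X \<and> q \<in> U \<and> P X q}"
  then obtain U X q where r: "r = X q" "local_param surface U X" "q \<in> U" "P X q" by blast
  obtain x where x: "x \<in> sphere 0 1" "X q = T x"
    by (rule local_param_point[OF r(2,3)])
  then show "r \<in> T ` {x \<in> sphere 0 1. Q x}"
    using assms[OF r(2,3) x(2)] r(1,4) by blast
next
  fix r assume "r \<in> T ` {x \<in> sphere 0 1. Q x}"
  then obtain x where x: "x \<in> sphere 0 1" "Q x" "r = T x" by blast
  obtain U X q where X: "local_param surface U X" "q \<in> U" "X q = T x"
    by (rule local_param_exists[OF x(1)])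
  then show "r \<in> {X q | U X q. local_param surface U X \<and> q \<in> U \<and> P X q}"
  proof -
    have "P X q" using assms[OF X] x(2) by blast
    then show ?thesis unfolding x(3) X(3)[symmetric] using X(1,2) by blast
  qed
qed

lemma umbilics_surface: "umbilics surface = T ` {x \<in> sphere 0 1. eigenvalue_gap p x = 0}"
  unfolding umbilics_def by (rule point_set_eq) (rule local_param_umbilic)

lemma tropic_surface: "tropic surface = T ` {x \<in> sphere 0 1. conic_v p x = B / (B + C)}"
  unfolding tropic_def by (rule point_set_eq) (rule local_param_tropic)

lemma two_direction_region_surface: "two_direction_region surface = T ` nonumbilic p"
  unfolding two_direction_region_def nonumbilic_def
proof (rule point_set_eq)
  fix U X q x assume "local_param surface U X" "q \<in> U" "X q = T x"
  from local_param_discriminant[OF this] obtain c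
    where c: "0 < c" and disc: "(M1 X q)\<^sup>2 - 4 * L1 X q * N1 X q = c * (eigenvalue_gap p x)\<^sup>2" by blast
  show "0 < (M1 X q)\<^sup>2 - 4 * L1 X q * N1 X q \<longleftrightarrow> eigenvalue_gap p x \<noteq> 0"
    unfolding disc using c by (simp add: zero_less_mult_iff)
qed

text \<open>A quadratic equation from a pencil with a definite member has a double root only if it vanishes
  identically.\<close>
lemma LPL_surface: "LPL surface = {}"
proof -
  have "LPL surface = T ` {x \<in> sphere 0 1. False}"
    unfolding LPL_def
  proof (rule point_set_eq)
    fix U X q x assume lp: "local_param surface U X" "q \<in> U" "X q = T x"
    show "\<not> (L1 X q = 0 \<and> M1 X q = 0 \<and> N1 X q = 0) \<and> (M1 X q)\<^sup>2 - 4 * L1 X q * N1 X q = 0 \<longleftrightarrow> False"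
      using local_param_discriminant[OF lp] local_param_umbilic[OF lp] by auto
  qed
  then show ?thesis by simp
qed

lemma principal_directions_surface:
  assumes x: "x \<in> nonumbilic p"
  shows "principal_directions surface (T x) = {L ` first_line p x, L ` second_line p x}"
proof -
  note xs = nonumbilicD(1)[OF x]
  define dirs where "dirs X q = {span {du *\<^sub>R pdu X q + dv *\<^sub>R pdv X q} | du dv. (du, dv) \<noteq> (0, 0) \<and>
          L1 X q * dv\<^sup>2 + M1 X q * du * dv + N1 X q * du\<^sup>2 = 0}" for X q
  have dirs: "dirs X q = (`) L ` {first_line p x, second_line p x}"
    if lp: "local_param surface U X" "q \<in> U" "X q = T x" for U X q
  proof -
    have image: "{f (g w) | w. Q w} = f ` {g w | w. Q w}"
      for f :: "(real^3) set \<Rightarrow> (real^3) set" and g :: "real^3 \<Rightarrow> (real^3) set" and Q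
      by blast
    show ?thesis
      unfolding dirs_def local_param_principal[OF lp] eigenlines(1)[OF p x, symmetric] by (rule image)
  qed
  have mem: "l \<in> principal_directions surface (T x)
      \<longleftrightarrow> (\<exists>U X q. local_param surface U X \<and> q \<in> U \<and> X q = T x \<and> l \<in> dirs X q)" for l
    unfolding principal_directions_def dirs_def mem_Collect_eq by (simp only: ex_simps conj_ac)
  obtain U X q where "local_param surface U X" "q \<in> U" "X q = T x"
    by (rule local_param_exists[OF xs])
  then have "l \<in> principal_directions surface (T x) \<longleftrightarrow> l \<in> (`) L ` {first_line p x, second_line p x}" for l
    unfolding mem using dirs by metis
  then show ?thesis by auto
qed

definition first_leaves :: "(real^3) set set" where
  "first_leaves = (\<lambda>x. T ` {y \<in> nonumbilic p. leaf_label p y = leaf_label p x}) ` nonumbilic p"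

definition second_leaves :: "(real^3) set set" where
  "second_leaves = (\<lambda>x. T ` {y \<in> nonumbilic p. second_leaf_label p y = second_leaf_label p x}) ` nonumbilic p"

lemma principal_configuration_surface:
  "(first_leaves, second_leaves, T ` {x \<in> sphere 0 1. eigenvalue_gap p x = 0},
     T ` {x \<in> sphere 0 1. conic_v p x = B / (B + C)}, {}) \<in> principal_configurations surface"
proof -
  define R where "R = two_direction_region surface"
  define D1 where "D1 q = L ` first_line p (inv T q)" for q
  define D2 where "D2 q = L ` second_line p (inv T q)" for q
  have D: "D1 (T x) = L ` first_line p x" "D2 (T x) = L ` second_line p x" for x
    by (simp_all add: D1_def D2_def inj_T)
  have R1: "R = (\<lambda>x. o' + L x) ` nonumbilic p"
    unfolding R_def two_direction_region_surface T_def ..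
  have q: "0 < 1 - p" "1 - p < 1" using p by simp_all
  have R2: "R = (\<lambda>x. o' + (L \<circ> flip) x) ` nonumbilic (1 - p)"
    unfolding R1 flip_image_nonumbilic[of p, symmetric] by (simp add: image_image)
  have L2: "linear (L \<circ> flip)" "inj (L \<circ> flip)"
    using linear_compose[OF linear_flip linear_L] inj_compose[OF inj_L inj_flip] .
  have E1: "D1 (o' + L x) = L ` first_line p x" for x
    using D(1)[of x] by (simp add: T_def)
  have E2: "D2 (o' + (L \<circ> flip) x) = (L \<circ> flip) ` first_line (1 - p) x" for x
    using D(2)[of "flip x"] by (simp add: T_def second_line_def image_image)
  have "principal_line_fields surface D1 D2"
    unfolding principal_line_fields_def R_def[symmetric]
  proof (intro conjI ballI)
    show "continuous_line_field R D1" by (rule continuous_first_line[OF p linear_L inj_L R1 E1])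
    show "continuous_line_field R D2" by (rule continuous_first_line[OF q L2 R2 E2])
    fix r assume "r \<in> R"
    then obtain x where x: "x \<in> nonumbilic p" "r = T x"
      unfolding R_def two_direction_region_surface by blast
    show "D1 r \<noteq> D2 r"
      unfolding x(2) D using eigenlines(2)[OF p x(1)] inj_L by (simp add: inj_image_eq_iff)
    show "principal_directions surface r = {D1 r, D2 r}"
      unfolding x(2) D by (rule principal_directions_surface[OF x(1)])
  qed
  moreover have "foliation R D1 = first_leaves"
    unfolding foliation_first_line[OF p linear_L inj_L R1 E1] first_leaves_def T_def ..
  moreover have "foliation R D2 = second_leaves"
  proof -
    have fib: "(\<lambda>y. o' + (L \<circ> flip) y) ` {y \<in> nonumbilic (1 - p). leaf_label (1 - p) y = leaf_label (1 - p) (flip x)}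
        = T ` {y \<in> nonumbilic p. second_leaf_label p y = second_leaf_label p x}" for x
    proof -
      have "flip ` {y \<in> nonumbilic (1 - p). leaf_label (1 - p) y = leaf_label (1 - p) (flip x)}
          = {y \<in> nonumbilic p. second_leaf_label p y = second_leaf_label p x}"
        unfolding second_leaf_label_def flip_image_nonumbilic[of p, symmetric] by force
      from arg_cong[OF this, of "(`) T"] show ?thesis by (simp add: image_image T_def)
    qed
    have "foliation R D2 = (\<lambda>x. (\<lambda>y. o' + (L \<circ> flip) y) ` {y \<in> nonumbilic (1 - p). leaf_label (1 - p) y = leaf_label (1 - p) x}) ` flip ` nonumbilic p"
      unfolding foliation_first_line[OF q L2 R2 E2]
      using flip_image_nonumbilic[of "1 - p"] by simp
    also have "\<dots> = second_leaves"
      unfolding image_image fib second_leaves_def ..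
    finally show ?thesis .
  qed
  ultimately show ?thesis
    unfolding principal_configurations_def R_def
    using umbilics_surface tropic_surface LPL_surface by blast
qed

end

section \<open>The homeomorphism between two ellipsoids\<close>

text \<open>The increasing homeomorphism of the unit interval that multiplies the odds \<open>v / (1 - v)\<close> by \<open>k\<close>. The odds of
  \<open>B / (B + C)\<close> are \<open>B / C\<close>, so that a suitable \<open>k\<close> matches the tropics.\<close>
definition moebius :: "real \<Rightarrow> real \<Rightarrow> real" where
  "moebius k v = k * v / (1 - v + k * v)"

lemma moebius_denominator: "0 < (k :: real) \<Longrightarrow> 0 \<le> v \<Longrightarrow> v \<le> 1 \<Longrightarrow> 0 < 1 - v + k * v"
  by (cases "v = 1") (auto simp: add_pos_nonneg)

lemma moebius_range:
  assumes "0 < k" "0 \<le> v" "v \<le> 1"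
  shows "0 \<le> moebius k v" "moebius k v \<le> 1"
    and "moebius k v = 0 \<longleftrightarrow> v = 0" "1 - moebius k v = (1 - v) / (1 - v + k * v)"
  using moebius_denominator[OF assms] assms by (auto simp: moebius_def divide_simps)

lemma moebius_inverse:
  assumes "0 < k" "0 \<le> v" "v \<le> 1"
  shows "moebius (1 / k) (moebius k v) = v"
proof -
  define d where "d = 1 - v + k * v"
  have d: "0 < d" using moebius_denominator[OF assms] by (simp add: d_def)
  have 1: "1 - moebius k v = (1 - v) / d" "1 / k * moebius k v = v / d"
    using moebius_range(4)[OF assms] assms(1) by (simp_all add: d_def moebius_def)
  have "moebius (1 / k) (moebius k v) = (v / d) / ((1 - v) / d + v / d)"
    unfolding moebius_def[of "1 / k"] 1 ..
  also have "(1 - v) / d + v / d = 1 / d" by (simp add: add_divide_distrib[symmetric])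
  finally show ?thesis using d by simp
qed

lemma moebius_inj:
  assumes "0 < k" "0 \<le> v" "v \<le> 1" "0 \<le> w" "w \<le> 1"
  shows "moebius k v = moebius k w \<longleftrightarrow> v = w"
  using moebius_inverse[of k v] moebius_inverse[of k w] assms by metis

definition transfer :: "real \<Rightarrow> real \<Rightarrow> real \<Rightarrow> real^3 \<Rightarrow> real^3" where
  "transfer p p' k x = vector
     [sgn (x$1) * sqrt ((1 - conic_u p x) * (p' + (1 - p') * moebius k (conic_v p x))),
      sgn (x$2) * sqrt (conic_u p x * moebius k (conic_v p x)),
      sgn (x$3) * sqrt ((1 - moebius k (conic_v p x)) * (1 - p' + p' * conic_u p x))]"

lemma sgn_sqrt:
  fixes r s :: real
  assumes "0 \<le> s" "r = 0 \<longleftrightarrow> s = 0"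
  shows "(sgn r * sqrt s)\<^sup>2 = s" "sgn (sgn r * sqrt s) = sgn r"
  using assms by (auto simp: sgn_if power_mult_distrib)

text \<open>The jump of the sign is harmless where the square root tends to zero.\<close>
lemma continuous_on_sgn_sqrt:
  fixes f g :: "'a::topological_space \<Rightarrow> real"
  assumes f: "continuous_on S f" and g: "continuous_on S g"
    and 0: "\<And>x. x \<in> S \<Longrightarrow> 0 \<le> g x \<and> (f x = 0 \<longrightarrow> g x = 0)"
  shows "continuous_on S (\<lambda>x. sgn (f x) * sqrt (g x))"
  unfolding continuous_on_def
proof
  fix x assume x: "x \<in> S"
  have fx: "(f \<longlongrightarrow> f x) (at x within S)"
    using f x by (simp add: continuous_on_def)
  have gx: "((\<lambda>x. sqrt (g x)) \<longlongrightarrow> sqrt (g x)) (at x within S)"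
    by (rule tendsto_real_sqrt) (use g x in \<open>simp add: continuous_on_def\<close>)
  show "((\<lambda>x. sgn (f x) * sqrt (g x)) \<longlongrightarrow> sgn (f x) * sqrt (g x)) (at x within S)"
  proof (cases "f x = 0")
    case True
    then have g0: "g x = 0" using 0[OF x] by simp
    have "norm (sgn (f y) * sqrt (g y)) \<le> \<bar>sqrt (g y)\<bar>" for y
      by (cases "f y" "0 :: real" rule: linorder_cases) simp_all
    then have "((\<lambda>y. sgn (f y) * sqrt (g y)) \<longlongrightarrow> 0) (at x within S)"
      by (intro Lim_null_comparison[OF always_eventually tendsto_rabs_zero[OF gx[unfolded g0 real_sqrt_zero]]] allI)
    then show ?thesis using g0 by simp
  next
    case False
    then show ?thesis by (rule tendsto_mult[OF tendsto_sgn[OF fx] gx])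
  qed
qed

text \<open>The values prescribed for the squares of the new coordinates are nonnegative and vanish exactly where the old
  coordinates do. So the signs can be kept, and the transfer map is continuous across the coordinate planes.\<close>
lemma transfer_squares:
  assumes p: "0 < p" "p < 1" and p': "0 < p'" "p' < 1" and k: "0 < k" and x: "x \<in> sphere 0 1"
  defines "u \<equiv> conic_u p x" and "w \<equiv> moebius k (conic_v p x)"
  shows "0 \<le> (1 - u) * (p' + (1 - p') * w)" "0 \<le> u * w" "0 \<le> (1 - w) * (1 - p' + p' * u)"
    and "x$1 = 0 \<longleftrightarrow> (1 - u) * (p' + (1 - p') * w) = 0" "x$2 = 0 \<longleftrightarrow> u * w = 0"
      "x$3 = 0 \<longleftrightarrow> (1 - w) * (1 - p' + p' * u) = 0"
proof -
  define v where "v = conic_v p x"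
  have u: "0 \<le> u" "u \<le> 1" and v: "0 \<le> v" "v \<le> 1"
    using conic_nonneg[OF p, of x] conic_le_1[OF p x] by (simp_all add: u_def v_def)
  have w: "0 \<le> w" "w \<le> 1" "w = 0 \<longleftrightarrow> v = 0" "1 - w = 0 \<longleftrightarrow> v = 1"
  proof -
    have wv: "w = moebius k v" by (simp only: w_def v_def)
    show "0 \<le> w" "w \<le> 1" "w = 0 \<longleftrightarrow> v = 0"
      unfolding wv by (rule moebius_range[OF k v])+
    show "1 - w = 0 \<longleftrightarrow> v = 1"
      unfolding wv moebius_range(4)[OF k v] using moebius_denominator[OF k v] by simp
  qed
  have pos: "0 < p + (1 - p) * v" "0 < p' + (1 - p') * w" "0 < 1 - p + p * u" "0 < 1 - p' + p' * u"
    using p p' u v w by (simp_all add: add_pos_nonneg)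
  show "0 \<le> (1 - u) * (p' + (1 - p') * w)" "0 \<le> u * w" "0 \<le> (1 - w) * (1 - p' + p' * u)"
    using u w pos by simp_all
  have "x$1 = 0 \<longleftrightarrow> (1 - u) * (p + (1 - p) * v) = 0"
    unfolding u_def v_def sq13_conic(1)[OF p x, symmetric] by simp
  then show "x$1 = 0 \<longleftrightarrow> (1 - u) * (p' + (1 - p') * w) = 0"
    using pos(1,2) by simp
  have "x$2 = 0 \<longleftrightarrow> u * v = 0"
    unfolding u_def v_def sq2_conic[OF p, symmetric] by simp
  then show "x$2 = 0 \<longleftrightarrow> u * w = 0"
    using w(3) by simp
  have "x$3 = 0 \<longleftrightarrow> (1 - v) * (1 - p + p * u) = 0"
    unfolding u_def v_def sq13_conic(2)[OF p x, symmetric] by simp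
  then have "x$3 = 0 \<longleftrightarrow> 1 - w = 0"
    unfolding w(4) using pos(3) by simp
  then show "x$3 = 0 \<longleftrightarrow> (1 - w) * (1 - p' + p' * u) = 0"
    using pos(4) by simp
qed

lemma transfer_conic:
  assumes p: "0 < p" "p < 1" and p': "0 < p'" "p' < 1" and k: "0 < k" and x: "x \<in> sphere 0 1"
  shows "transfer p p' k x \<in> sphere 0 1" "conic_u p' (transfer p p' k x) = conic_u p x"
    and "conic_v p' (transfer p p' k x) = moebius k (conic_v p x)"
    and "sgn (transfer p p' k x $ i) = sgn (x $ i)"
proof -
  note tr = transfer_squares[OF assms]
  have v: "0 \<le> conic_v p x" "conic_v p x \<le> 1"
    using conic_nonneg[OF p, of x] conic_le_1[OF p x] by simp_all
  have "(transfer p p' k x $ 1)\<^sup>2 = (1 - conic_u p x) * (p' + (1 - p') * moebius k (conic_v p x))"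
    "(transfer p p' k x $ 2)\<^sup>2 = conic_u p x * moebius k (conic_v p x)"
    "(transfer p p' k x $ 3)\<^sup>2 = (1 - moebius k (conic_v p x)) * (1 - p' + p' * conic_u p x)"
    unfolding transfer_def vector_3 using tr by (simp_all only: sgn_sqrt(1))
  from conic_unique[OF p' conic_nonneg(1)[OF p] moebius_range(1)[OF k v] this]
  show "transfer p p' k x \<in> sphere 0 1" "conic_u p' (transfer p p' k x) = conic_u p x"
    "conic_v p' (transfer p p' k x) = moebius k (conic_v p x)" .
  have "sgn (transfer p p' k x $ 1) = sgn (x$1)" "sgn (transfer p p' k x $ 2) = sgn (x$2)"
    "sgn (transfer p p' k x $ 3) = sgn (x$3)"
    unfolding transfer_def vector_3 using tr by (simp_all only: sgn_sqrt(2))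
  then show "sgn (transfer p p' k x $ i) = sgn (x $ i)"
    using exhaust_3[of i] by auto
qed

lemma transfer_inverse:
  assumes p: "0 < p" "p < 1" and p': "0 < p'" "p' < 1" and k: "0 < k" and x: "x \<in> sphere 0 1"
  shows "transfer p' p (1 / k) (transfer p p' k x) = x"
proof -
  note tr = transfer_conic[OF assms]
  have v: "0 \<le> conic_v p x" "conic_v p x \<le> 1"
    using conic_nonneg[OF p, of x] conic_le_1[OF p x] by simp_all
  have sq: "sgn r * sqrt (r\<^sup>2) = r" for r :: real by (simp add: sgn_mult_abs)
  show ?thesis
    unfolding transfer_def[of p' p] tr moebius_inverse[OF k v]
      sq13_conic[OF p x, symmetric] sq2_conic[OF p, symmetric] sq
    by (simp add: vec_eq_iff forall_3)
qed

lemma continuous_on_transfer: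
  assumes p: "0 < p" "p < 1" and p': "0 < p'" "p' < 1" and k: "0 < k"
  shows "continuous_on (sphere 0 1) (transfer p p' k)"
proof -
  have u: "continuous_on (sphere 0 1) (conic_u p)" and v: "continuous_on (sphere 0 1) (conic_v p)"
    using continuous_on_conic[OF continuous_on_id] by auto
  have d: "1 - conic_v p x + k * conic_v p x \<noteq> 0" if "x \<in> sphere 0 1" for x
    using moebius_denominator[OF k conic_nonneg(2)[OF p] conic_le_1(2)[OF p that]] by simp
  have w: "continuous_on (sphere 0 1) (\<lambda>x. moebius k (conic_v p x))"
    unfolding moebius_def
    by (rule continuous_on_divide) (use d v in \<open>auto intro!: continuous_on_add continuous_on_diff continuous_on_mult continuous_on_const\<close>)
  have nth: "continuous_on (sphere 0 1) (\<lambda>x :: real^3. x $ i)" for i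
    by (intro continuous_on_component continuous_on_id)
  note tr = transfer_squares[OF p p' k]
  have "continuous_on (sphere 0 1) (\<lambda>x. transfer p p' k x $ 1)"
    "continuous_on (sphere 0 1) (\<lambda>x. transfer p p' k x $ 2)"
    "continuous_on (sphere 0 1) (\<lambda>x. transfer p p' k x $ 3)"
    unfolding transfer_def vector_3
    by (rule continuous_on_sgn_sqrt[OF nth];
        (intro continuous_on_add continuous_on_diff continuous_on_mult continuous_on_const u w
          | use tr in blast))+
  then have "continuous_on (sphere 0 1) (\<lambda>x. transfer p p' k x $ i)" for i
    using exhaust_3[of i] by auto
  then show ?thesis by (rule continuous_on_vec_lambda[of _ "\<lambda>i x. transfer p p' k x $ i", simplified])
qed

lemma homeomorphism_transfer:
  assumes p: "0 < p" "p < 1" and p': "0 < p'" "p' < 1" and k: "0 < k"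
  shows "homeomorphism (sphere 0 1) (sphere 0 1) (transfer p p' k) (transfer p' p (1 / k))"
proof -
  have k': "0 < 1 / k" using k by simp
  have inv: "transfer p p' k (transfer p' p (1 / k) y) = y" if "y \<in> sphere 0 1" for y
    using transfer_inverse[OF p' p k' that] by simp
  show ?thesis
  proof (rule homeomorphismI)
    show "continuous_on (sphere 0 1) (transfer p p' k)" "continuous_on (sphere 0 1) (transfer p' p (1 / k))"
      using continuous_on_transfer p p' k k' by blast+
    show "transfer p p' k ` sphere 0 1 \<subseteq> sphere 0 1" "transfer p' p (1 / k) ` sphere 0 1 \<subseteq> sphere 0 1"
      using transfer_conic(1)[OF p p' k] transfer_conic(1)[OF p' p k'] by blast+
  qed (use transfer_inverse[OF p p' k] inv in auto)
qed

lemma transported_fibres: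
  assumes N: "f ` N = N'" and lab: "\<And>x y. x \<in> N \<Longrightarrow> y \<in> N \<Longrightarrow> lab' (f y) = lab' (f x) \<longleftrightarrow> lab y = lab x"
    and h: "\<And>x. x \<in> N \<Longrightarrow> h (T x) = T' (f x)"
  shows "(`) h ` (\<lambda>x. T ` {y \<in> N. lab y = lab x}) ` N = (\<lambda>x. T' ` {y \<in> N'. lab' y = lab' x}) ` N'"
proof -
  have "h ` T ` {y \<in> N. lab y = lab x} = T' ` {y \<in> N'. lab' y = lab' (f x)}" if x: "x \<in> N" for x
  proof -
    have "h ` T ` {y \<in> N. lab y = lab x} = T' ` f ` {y \<in> N. lab y = lab x}"
      using h by (simp add: image_image)
    also have "f ` {y \<in> N. lab y = lab x} = {y \<in> N'. lab' y = lab' (f x)}"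
      using lab[OF x] N by auto
    finally show ?thesis .
  qed
  then show ?thesis unfolding N[symmetric] image_image by (rule image_cong[OF refl])
qed

lemma eigenvalue_gap_eq_0_iff:
  assumes p: "0 < p" "p < 1"
  shows "eigenvalue_gap p x = 0 \<longleftrightarrow> conic_u p x = 0 \<and> conic_v p x = 0"
  unfolding conic_eqs(2)[OF p]
  using conic_nonneg[OF p, of x] p by (simp add: add_nonneg_eq_0_iff)

lemma (in lorentz_ellipsoid) homeomorphism_T: "homeomorphism (sphere 0 1) surface T (inv T)"
proof -
  have "continuous_on (sphere 0 1) T"
    unfolding T_def using linear_continuous_on[OF linear_L[unfolded linear_conv_bounded_linear]]
    by (intro continuous_on_add continuous_on_const)
  then obtain g where g: "homeomorphism (sphere 0 1) surface T g"
    using homeomorphism_compact[of "sphere 0 1" T surface] inj_T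
    by (auto simp: surface_def intro: inj_on_subset)
  have "g q = inv T q" if "q \<in> surface" for q
    using that homeomorphism_apply1[OF g] inj_T by (auto simp: surface_def)
  then show ?thesis
    using homeomorphism_cong[OF g refl refl] by auto
qed

text \<open>All members of the configuration are described by \<open>u\<close>, \<open>v\<close> and signs of coordinates, and the transfer map
  changes these only by an injective reparametrization of \<open>v\<close> that fixes \<open>0\<close>.\<close>
lemma lorentz_ellipsoids_equivalent:
  assumes "lorentz_ellipsoid La A1 B1 C1" and "lorentz_ellipsoid Lb A2 B2 C2"
  shows "C0_principally_equivalent (lorentz_ellipsoid.surface o1 La) (lorentz_ellipsoid.surface o2 Lb)"
proof -
  interpret E: lorentz_ellipsoid o1 La A1 B1 C1 by fact
  interpret F: lorentz_ellipsoid o2 Lb A2 B2 C2 by fact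
  \<comment> \<open>The quotient of the odds of the two tropic values.\<close>
  define k where "k = (B2 / C2) / (B1 / C1)"
  have k: "0 < k" using E.order F.order by (simp add: k_def)
  define f where "f = transfer E.p F.p k"
  define g where "g = transfer F.p E.p (1 / k)"
  have hom: "homeomorphism (sphere 0 1) (sphere 0 1) f g"
    unfolding f_def g_def by (rule homeomorphism_transfer[OF E.p F.p k])
  note tr = transfer_conic[OF E.p F.p k, folded f_def]
  have v01: "0 \<le> conic_v E.p x" "conic_v E.p x \<le> 1" if "x \<in> sphere 0 1" for x
    using conic_nonneg(2)[OF E.p] conic_le_1(2)[OF E.p that] by simp_all
  define h where "h = F.T \<circ> f \<circ> inv E.T"
  have hT: "h (E.T x) = F.T (f x)" for x by (simp add: h_def E.inj_T)
  have homT: "homeomorphism (sphere 0 1) E.surface E.T (inv E.T)"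
    "homeomorphism (sphere 0 1) F.surface F.T (inv F.T)"
    using E.homeomorphism_T F.homeomorphism_T .
  have homh: "homeomorphism E.surface F.surface h (E.T \<circ> g \<circ> inv F.T)"
    using homeomorphism_compose[OF homeomorphism_compose[OF homeomorphism_symD[OF homT(1)] hom] homT(2)]
    by (simp add: h_def comp_assoc)
  have fS: "f ` sphere 0 1 = sphere 0 1" using hom by (simp add: homeomorphism_def)
  have image: "f ` {x \<in> sphere 0 1. P x} = {y \<in> sphere 0 1. Q y}"
    if PQ: "\<And>x. x \<in> sphere 0 1 \<Longrightarrow> Q (f x) \<longleftrightarrow> P x" for P Q
  proof (intro equalityI subsetI)
    fix y assume "y \<in> f ` {x \<in> sphere 0 1. P x}"
    then obtain x where x: "x \<in> sphere 0 1" "P x" "y = f x" by blast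
    then show "y \<in> {y \<in> sphere 0 1. Q y}" using PQ[OF x(1)] tr(1)[OF x(1)] by simp
  next
    fix y assume y: "y \<in> {y \<in> sphere 0 1. Q y}"
    then have "y \<in> f ` sphere 0 1" unfolding fS by blast
    then obtain x where x: "x \<in> sphere 0 1" "y = f x" by blast
    then show "y \<in> f ` {x \<in> sphere 0 1. P x}" using PQ[OF x(1)] y by blast
  qed
  have eigenvalue_gap: "eigenvalue_gap F.p (f x) = 0 \<longleftrightarrow> eigenvalue_gap E.p x = 0" if x: "x \<in> sphere 0 1" for x
    unfolding eigenvalue_gap_eq_0_iff[OF F.p] eigenvalue_gap_eq_0_iff[OF E.p] tr[OF x] moebius_range(3)[OF k v01[OF x]] ..
  have fN: "f ` nonumbilic E.p = nonumbilic F.p"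
    unfolding nonumbilic_def by (rule image) (simp add: eigenvalue_gap)
  have lab1: "leaf_label F.p (f y) = leaf_label F.p (f x) \<longleftrightarrow> leaf_label E.p y = leaf_label E.p x"
    if "x \<in> nonumbilic E.p" "y \<in> nonumbilic E.p" for x y
    unfolding leaf_label_def prod.inject
    using that[THEN nonumbilicD(1)] by (simp only: tr moebius_inj[OF k v01 v01])
  have lab2: "second_leaf_label F.p (f y) = second_leaf_label F.p (f x) \<longleftrightarrow> second_leaf_label E.p y = second_leaf_label E.p x"
    if "x \<in> nonumbilic E.p" "y \<in> nonumbilic E.p" for x y
    unfolding second_leaf_label_eq prod.inject
    using that[THEN nonumbilicD(1)] by (simp only: tr)
  have leaves: "(`) h ` E.first_leaves = F.first_leaves" "(`) h ` E.second_leaves = F.second_leaves"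
    unfolding E.first_leaves_def F.first_leaves_def E.second_leaves_def F.second_leaves_def
    using transported_fibres[where f=f and lab="leaf_label E.p" and lab'="leaf_label F.p" and h=h and T=E.T and T'=F.T, OF fN lab1 hT]
      transported_fibres[where f=f and lab="second_leaf_label E.p" and lab'="second_leaf_label F.p" and h=h and T=E.T and T'=F.T, OF fN lab2 hT]
    by simp_all
  have hS: "h ` E.T ` Z = F.T ` f ` Z" for Z by (simp add: image_image hT)
  have trop: "moebius k (B1 / (B1 + C1)) = B2 / (B2 + C2)"
  proof -
    have pos: "0 < B1" "0 < C1" "0 < B2" "0 < C2" using E.order F.order by simp_all
    have "1 - B1 / (B1 + C1) = C1 / (B1 + C1)" using pos by (simp add: field_simps)
    moreover have "k * (B1 / (B1 + C1)) = (B2 / C2) * (C1 / (B1 + C1))" using pos by (simp add: k_def)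
    ultimately have "moebius k (B1 / (B1 + C1))
        = (B2 / C2) * (C1 / (B1 + C1)) / (C1 / (B1 + C1) + (B2 / C2) * (C1 / (B1 + C1)))"
      by (simp only: moebius_def)
    also have "\<dots> = (B2 / C2) / (1 + B2 / C2)"
    proof -
      have ratio: "b * c / (c + b * c) = b / (1 + b)" if "0 < c" for b c :: real
      proof -
        have "b * c / (c + b * c) = (c * b) / (c * (1 + b))" by (simp add: algebra_simps)
        then show ?thesis using that by simp
      qed
      show ?thesis by (rule ratio) (use pos in simp)
    qed
    also have "\<dots> = B2 / (B2 + C2)" using pos by (simp add: field_simps)
    finally show ?thesis .
  qed
  have "map_configuration h
     (E.first_leaves, E.second_leaves, E.T ` {x \<in> sphere 0 1. eigenvalue_gap E.p x = 0},
       E.T ` {x \<in> sphere 0 1. conic_v E.p x = B1 / (B1 + C1)}, {})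
     = (F.first_leaves, F.second_leaves, F.T ` {x \<in> sphere 0 1. eigenvalue_gap F.p x = 0},
       F.T ` {x \<in> sphere 0 1. conic_v F.p x = B2 / (B2 + C2)}, {})"
  proof -
    have "f ` {x \<in> sphere 0 1. eigenvalue_gap E.p x = 0} = {x \<in> sphere 0 1. eigenvalue_gap F.p x = 0}"
      by (rule image) (rule eigenvalue_gap)
    moreover have "f ` {x \<in> sphere 0 1. conic_v E.p x = B1 / (B1 + C1)} = {x \<in> sphere 0 1. conic_v F.p x = B2 / (B2 + C2)}"
    proof (rule image)
      fix x :: "real^3" assume x: "x \<in> sphere 0 1"
      have b: "0 \<le> B1 / (B1 + C1)" "B1 / (B1 + C1) \<le> 1" using E.order by simp_all
      show "conic_v F.p (f x) = B2 / (B2 + C2) \<longleftrightarrow> conic_v E.p x = B1 / (B1 + C1)"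
        unfolding tr[OF x] trop[symmetric] moebius_inj[OF k v01[OF x] b] ..
    qed
    ultimately show ?thesis by (simp only: map_configuration.simps leaves hS image_empty)
  qed
  then show ?thesis
    unfolding C0_principally_equivalent_def
    by (intro exI conjI bexI) (rule homh, assumption, rule F.principal_configuration_surface,
        rule E.principal_configuration_surface)
qed

section \<open>Ellipsoids as affine images of the sphere\<close>

text \<open>\<open>L\<close> maps the coordinate axes to the frame vectors scaled by the semi-axes. The products with the frame vectors
  then recover the scaled coordinates; the sign for the timelike vector disappears in the square.\<close>
lemma frame_ellipsoid:
  assumes fr: "minkowski_frame e1 e2 e3" and ord: "0 < b" "b < a" "0 < c"
  obtains L A B C where "lorentz_ellipsoid L A B C"
    "lorentz_ellipsoid.surface o' L = {p. (minner (p - o') e1 / a)\<^sup>2 + (minner (p - o') e2 / b)\<^sup>2 + (minner (p - o') e3 / c)\<^sup>2 = 1}"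
proof -
  define L :: "real^3 \<Rightarrow> real^3" where "L x = (a * x$1) *\<^sub>R e1 + (b * x$2) *\<^sub>R e2 + (c * x$3) *\<^sub>R e3" for x
  have lin: "linear L" by (intro linearI) (simp_all add: L_def algebra_simps)
  have bil: "minner (x + y) z = minner x z + minner y z" "minner (r *\<^sub>R x) z = r * minner x z"
    "minner z x = minner x z" for x y z r
    by (simp_all add: minner_def algebra_simps)
  have e: "minner e1 e1 = 1" "minner e2 e2 = 1" "minner e3 e3 = - 1" "minner e1 e2 = 0" "minner e1 e3 = 0" "minner e2 e3 = 0"
     "minner e2 e1 = 0" "minner e3 e1 = 0" "minner e3 e2 = 0"
    using fr bil(3) by (simp_all add: minkowski_frame_def)
  have L: "minner (L x) e1 = a * x$1" "minner (L x) e2 = b * x$2" "minner (L x) e3 = - (c * x$3)" for x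
    by (simp_all add: L_def bil(1,2) e)
  have "minner (L x) (L y) = a\<^sup>2 * (x$1 * y$1) + b\<^sup>2 * (x$2 * y$2) - c\<^sup>2 * (x$3 * y$3)" for x y
  proof -
    have "minner (L x) (L y) = a * x$1 * minner (L y) e1 + b * x$2 * minner (L y) e2 + c * x$3 * minner (L y) e3"
      by (subst L_def[of x]) (simp add: bil(1,2) bil(3)[of "L y"])
    then show ?thesis unfolding L by (simp add: power2_eq_square algebra_simps)
  qed
  then have E: "lorentz_ellipsoid L (a\<^sup>2) (b\<^sup>2) (c\<^sup>2)"
    using lin ord unfolding lorentz_ellipsoid_def by (simp add: power_strict_mono)
  interpret lorentz_ellipsoid o' L "a\<^sup>2" "b\<^sup>2" "c\<^sup>2" by (rule E)
  obtain G where G: "\<And>x. L (G x) = x"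
    using linear_injective_isomorphism[OF lin inj_L] by metis
  have eq: "q \<in> surface \<longleftrightarrow> G (q - o') \<in> sphere 0 1" for q
  proof -
    have "q = T (G (q - o'))" by (simp add: T_def G)
    then show ?thesis unfolding surface_def by (metis T_eq_iff image_iff)
  qed
  have "q \<in> surface \<longleftrightarrow> (minner (q - o') e1 / a)\<^sup>2 + (minner (q - o') e2 / b)\<^sup>2 + (minner (q - o') e3 / c)\<^sup>2 = 1" for q
    unfolding eq in_sphere_iff using L[of "G (q - o')"] ord by (simp add: G)
  then show ?thesis using that[OF E] by blast
qed

lemma ellipsoid_is_lorentz_ellipsoid:
  assumes "M \<in> ellipsoids_distinct_axes"
  obtains o' L A B C where "lorentz_ellipsoid L A B C" "M = lorentz_ellipsoid.surface o' L"
proof -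
  obtain o' e1 e2 e3 a b c where fr: "minkowski_frame e1 e2 e3" and ord: "0 < a" "0 < b" "0 < c" "a \<noteq> b"
    and M: "M = {p. (minner (p - o') e1 / a)\<^sup>2 + (minner (p - o') e2 / b)\<^sup>2 + (minner (p - o') e3 / c)\<^sup>2 = 1}"
    using assms unfolding ellipsoids_distinct_axes_def by blast
  show ?thesis
  proof (cases "b < a")
    case True
    obtain L A B C where "lorentz_ellipsoid L A B C" "lorentz_ellipsoid.surface o' L = M"
      unfolding M by (rule frame_ellipsoid[OF fr ord(2) True ord(3)])
    then show ?thesis using that by blast
  next
    case False
    then have ab: "a < b" using ord(4) by simp
    have "minner e2 e1 = minner e1 e2" by (simp add: minner_def)
    then have fr': "minkowski_frame e2 e1 e3" using fr by (simp add: minkowski_frame_def)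
    have M': "M = {p. (minner (p - o') e2 / b)\<^sup>2 + (minner (p - o') e1 / a)\<^sup>2 + (minner (p - o') e3 / c)\<^sup>2 = 1}"
      unfolding M by (simp only: add.commute)
    obtain L A B C where "lorentz_ellipsoid L A B C" "lorentz_ellipsoid.surface o' L = M"
      unfolding M' by (rule frame_ellipsoid[OF fr' ord(1) ab ord(3)])
    then show ?thesis using that by blast
  qed
qed

theorem theorem4p1:
  fixes M M' :: "(real^3) set"
  assumes "M \<in> ellipsoids_distinct_axes"
    and "M' \<in> ellipsoids_distinct_axes"
  shows "C0_principally_equivalent M M'"
proof -
  obtain o1 La A B C where M: "lorentz_ellipsoid La A B C" "M = lorentz_ellipsoid.surface o1 La"
    by (rule ellipsoid_is_lorentz_ellipsoid[OF assms(1)])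
  obtain o2 Lb A' B' C' where M': "lorentz_ellipsoid Lb A' B' C'" "M' = lorentz_ellipsoid.surface o2 Lb"
    by (rule ellipsoid_is_lorentz_ellipsoid[OF assms(2)])
  show ?thesis
    unfolding M(2) M'(2) by (rule lorentz_ellipsoids_equivalent[OF M(1) M'(1)])
qed

end
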